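(* (The Abramov Formula) Let $(X,\mathscr{X},\mu,T)$ be a probability measure preserving system and let $E\in\mathscr{X}$ sweep out $X$. Then $h_\mu(T)=\mu(E)\,h_{\mu_E}(T_E)$.
   Context: A (probability) measure preserving system $(X,\mathscr{X},\mu,T)$ consists of a standard probability space $(X,\mathscr{X},\mu)$ and a measurable map $T\colon X\to X$ preserving $\mu$; neither invertibility nor ergodicity is assumed. A set $E\in\mathscr{X}$ sweeps out $X$ if $\mu\big(\bigcup_{n=0}^\infty T^{-n}(E)\big)=1$ (in particular $\mu(E)>0$). Induced system: for $E\in\mathscr{X}$ with $\mu(E)>0$, let $\mathscr{X}_E=\{A\cap E:A\in\mathscr{X}\}$, $\mu_E(A)=\mu(A)/\mu(E)$ for $A\in\mathscr{X}_E$, and $r_E(x)=\min\{n\ge1:T^n(x)\in E\}$ for $x\in E$, which is finite for $\mu$-a.e. $x\in E$ by Poincaré recurrence. The induced map is $T_E(x)=T^{r_E(x)}(x)$, defined for $\mu$-a.e. $x\in E$ (null sets are ignored). Then $(E,\mathscr{X}_E,\mu_E,T_E)$ is a measure preserving system. Entropy: for a countable measurable partition $\mathcal{P}$, $H_\mu(\mathcal{P})=-\sum_{P\in\mathcal{P}}\mu(P)\log\mu(P)$ (with $0\log0=0$). For $\mathcal{P}$ with $H_\mu(\mathcal{P})<\infty$, $\bar H_\mu(T,\mathcal{P})=\lim_{n\to\infty}\frac1n H_\mu\big(\bigvee_{j=0}^{n-1}T^{-j}\mathcal{P}\big)$. The Kolmogorov–Sinai entropy $h_\mu(T)\in[0,\infty]$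 is the supremum of $\bar H_\mu(T,\mathcal{P})$ over all finite measurable partitions $\mathcal{P}$ of $X$ (equivalently, over all countable measurable partitions with finite entropy); $h_{\mu_E}(T_E)$ is defined in the same way for the induced system. *)

theory Defs
  imports "HOL-Probability.Probability"
begin

definition standard_borel_space :: "'a measure \<Rightarrow> bool" where
  "standard_borel_space M \<longleftrightarrow>
     (\<exists>S. topspace S = space M \<and> completely_metrizable_space S \<and> second_countable S \<and>
          sets M = sigma_sets (space M) {U. openin S U})"

(* Both usual conventions are admitted: the Borel sigma-algebra of a Polish space, or its
   completion with respect to the given measure. *)
definition standard_prob_space :: "'a measure \<Rightarrow> bool" where
  "standard_prob_space M \<longleftrightarrow>
     prob_space M \<and> (\<exists>N. standard_borel_space N \<and> (M = N \<or> M = completion N))"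

definition measure_preserving_map :: "'a measure \<Rightarrow> ('a \<Rightarrow> 'a) \<Rightarrow> bool" where
  "measure_preserving_map M T \<longleftrightarrow>
     T \<in> measurable M M \<and>
     (\<forall>A\<in>sets M. emeasure M (T -` A \<inter> space M) = emeasure M A)"

definition measure_preserving_system :: "'a measure \<Rightarrow> ('a \<Rightarrow> 'a) \<Rightarrow> bool" where
  "measure_preserving_system M T \<longleftrightarrow> standard_prob_space M \<and> measure_preserving_map M T"

definition sweeps_out :: "'a measure \<Rightarrow> ('a \<Rightarrow> 'a) \<Rightarrow> 'a set \<Rightarrow> bool" where
  "sweeps_out M T E \<longleftrightarrow>
     E \<in> sets M \<and> emeasure M (\<Union>n. (T ^^ n) -` E \<inter> space M) = 1"

definition induced_measure :: "'a measure \<Rightarrow> 'a set \<Rightarrow> 'a measure" where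
  "induced_measure M E = scale_measure (1 / emeasure M E) (restrict_space M E)"

definition return_time :: "('a \<Rightarrow> 'a) \<Rightarrow> 'a set \<Rightarrow> 'a \<Rightarrow> nat" where
  "return_time T E x = (LEAST n. 1 \<le> n \<and> (T ^^ n) x \<in> E)"

(* The induced map is only defined almost everywhere on E; it is completed by the identity on
   the null set of points of E that never return, so that it maps E to E measurably. *)
definition induced_map :: "('a \<Rightarrow> 'a) \<Rightarrow> 'a set \<Rightarrow> 'a \<Rightarrow> 'a" where
  "induced_map T E x =
     (if \<exists>n\<ge>1. (T ^^ n) x \<in> E then (T ^^ return_time T E x) x else x)"

definition finite_measurable_partition :: "'a measure \<Rightarrow> 'a set set \<Rightarrow> bool" where
  "finite_measurable_partition M P \<longleftrightarrow> finite P \<and> P \<subseteq> sets M \<and> partition_on (space M) P"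

(* Used for finite collections P only. *)
definition partition_entropy :: "'a measure \<Rightarrow> 'a set set \<Rightarrow> real" where
  "partition_entropy M P = - (\<Sum>A\<in>P. measure M A * ln (measure M A))"

(* The join of T^(-j) P for j < n: its cells are the sets of points with a prescribed
   P-itinerary f up to time n. The empty set may occur as a cell; it has no effect on entropy. *)
definition iterated_join :: "'a measure \<Rightarrow> ('a \<Rightarrow> 'a) \<Rightarrow> 'a set set \<Rightarrow> nat \<Rightarrow> 'a set set" where
  "iterated_join M T P n =
     {{x \<in> space M. \<forall>j<n. (T ^^ j) x \<in> f j} | f. \<forall>j<n. f j \<in> P}"

definition entropy_wrt :: "'a measure \<Rightarrow> ('a \<Rightarrow> 'a) \<Rightarrow> 'a set set \<Rightarrow> real" where
  "entropy_wrt M T P = lim (\<lambda>n. partition_entropy M (iterated_join M T P n) / real n)"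

definition KS_entropy :: "'a measure \<Rightarrow> ('a \<Rightarrow> 'a) \<Rightarrow> ennreal" where
  "KS_entropy M T = (SUP P\<in>{P. finite_measurable_partition M P}. ennreal (entropy_wrt M T P))"

end

theory Submission
  imports Defs
begin

text \<open>
Write \<open>c\<close> for the measure of \<open>E\<close> and \<open>S\<close> for the induced map. The idea is to read the entropy of
one and the same process with two clocks: time steps of \<open>T\<close>, and returns to \<open>E\<close>.

Let \<open>Q\<close> be a finite partition of the whole space such that \<open>E\<close> is a union of cells. A word \<open>w\<close> over \<open>Q\<close>
has a cylinder of measure \<open>p w\<close>, and with \<open>eta t = - t ln t\<close> the quantity
\<open>J w = (\<Sum>q\<in>Q. eta (p (w @ [q]))) - eta (p w)\<close> is \<open>p w\<close> times the entropy of the letter that follows \<open>w\<close>.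
Two facts about \<open>J\<close> carry the proof. It telescopes (the chain rule): summed over the inner nodes of a tree
of words it gives the entropy of the leaves minus that of the roots. And \<open>(\<Sum>q\<in>Q. J (q # w)) \<le> J w\<close>,
because a longer past leaves less uncertainty; this uses that \<open>T\<close> preserves the measure, which gives
\<open>p w = (\<Sum>q\<in>Q. p (q # w))\<close>.

For the clock of \<open>T\<close>, the sum \<open>G n\<close> of \<open>J\<close> over the words of length \<open>n\<close> is \<open>H (n + 1) - H n\<close>, where \<open>H n\<close> is
the entropy of the names of length \<open>n\<close>; it decreases to the entropy of \<open>T\<close> with respect to \<open>Q\<close>. For the
clock of \<open>S\<close>, look back not a fixed number of steps but to the \<open>(i + 1)\<close>-st most recent visit to \<open>E\<close>.
The words seen in this way are those that begin in \<open>E\<close> and contain exactly \<open>i + 1\<close> letters in \<open>E\<close>; none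
of them is a proper suffix of another, and they exhaust the space up to points with few visits, because almost
every point visits \<open>E\<close> infinitely often. Extending words to the left therefore squeezes the sum of \<open>J\<close>
over these words, for long windows, between \<open>G i\<close> and the limit of \<open>G\<close>.
But by the chain rule the same sums, taken over \<open>i < m\<close>, give the entropy of names that start in \<open>E\<close>
and are stopped at the \<open>m\<close>-th return, that is, \<open>c\<close> times an entropy of \<open>m\<close> steps of \<open>S\<close>, up to a constant.
Words are weighted by the invariant measure of the whole space throughout, so the number of visits during a
long time, which need not be close to its mean, never enters.

There are two points to settle. A name stopped at the \<open>m\<close>-th return determines the itinerary of \<open>S\<close> for
any partition of \<open>E\<close> into cells of \<open>Q\<close>; this gives \<open>c * h(S) \<le> h(T)\<close> (\<open>induced_entropy_le\<close>). For the
converse the return blocks may take infinitely many values, so they are cut off after \<open>l\<close> steps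
(\<open>excursion_partition\<close>). What is lost concerns only the times at which \<open>E\<close> has not been visited during the last
\<open>l\<close> steps, and costs at most \<open>ln (card Q)\<close> times their measure, which tends to \<open>0\<close> as \<open>l\<close> grows
(\<open>entropy_le_induced\<close>).
\<close>

section \<open>Entropy of a finite splitting of mass\<close>

definition eta :: "real \<Rightarrow> real" where
  "eta t = - t * ln t"

lemma eta_0 [simp]: "eta 0 = 0"
  by (simp add: eta_def)

lemma eta_divide:
  assumes "c > 0" "t \<ge> 0"
  shows "c * eta (t / c) = eta t + t * ln c"
  using assms by (cases "t = 0") (auto simp: eta_def ln_div field_simps)

text \<open>
For a vector \<open>v\<close> of masses this is the total mass times the Shannon entropy of the normalised vector. Leaving
the vector unnormalised makes the function homogeneous, so that concavity of entropy becomes superadditivity.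
\<close>
definition split_entropy :: "('b \<Rightarrow> real) \<Rightarrow> 'b set \<Rightarrow> real" where
  "split_entropy v A = (\<Sum>q\<in>A. eta (v q)) - eta (\<Sum>q\<in>A. v q)"

lemma split_entropy_alt:
  "split_entropy v A = (\<Sum>q\<in>A. v q * (ln (sum v A) - ln (v q)))"
  by (simp add: split_entropy_def eta_def algebra_simps sum_subtractf sum_negf flip: sum_distrib_right)

lemma split_entropy_nonneg:
  assumes "finite A" and nn: "\<And>q. q \<in> A \<Longrightarrow> 0 \<le> v q"
  shows "0 \<le> split_entropy v A"
  unfolding split_entropy_alt
proof (rule sum_nonneg)
  fix q assume q: "q \<in> A"
  have "v q \<le> sum v A"
    using member_le_sum[of q A v] assms q by auto
  then show "0 \<le> v q * (ln (sum v A) - ln (v q))"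
    using nn[OF q] by (cases "v q = 0") auto
qed

lemma eta_sum_le:
  assumes "finite A" "\<And>q. q \<in> A \<Longrightarrow> 0 \<le> v q"
  shows "eta (sum v A) \<le> (\<Sum>q\<in>A. eta (v q))"
  using split_entropy_nonneg[OF assms] by (simp add: split_entropy_def)

text \<open>
One summand of Gibbs' inequality, a rearrangement of \<open>ln x \<le> x - 1\<close>. The correction term \<open>s / t - v\<close> cancels
when the inequality is summed over a family with suitable \<open>t\<close>.
\<close>
lemma gibbs_term:
  fixes v s t :: real
  assumes "v \<ge> 0" "s > 0" "t > 0"
  shows "v * (ln s - ln v) \<le> v * ln t + (s / t - v)"
proof (cases "v = 0")
  case False
  then have v: "v > 0" using assms by auto
  have "ln (s / (t * v)) \<le> s / (t * v) - 1"
    using ln_le_minus_one[of "s / (t * v)"] assms v by simp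
  then have "v * ln (s / (t * v)) \<le> v * (s / (t * v) - 1)"
    using v by (intro mult_left_mono) auto
  also have "\<dots> = s / t - v" using v assms by (simp add: field_simps)
  finally show ?thesis using assms v by (simp add: ln_div ln_mult algebra_simps)
qed (use assms in auto)

text \<open>
The bound by the uniform distribution: in Gibbs' inequality \<open>t\<close> is the number of parts.
\<close>
lemma split_entropy_le_card:
  assumes "finite A" and nn: "\<And>q. q \<in> A \<Longrightarrow> 0 \<le> v q"
  shows "split_entropy v A \<le> sum v A * ln (card A)"
proof (cases "sum v A = 0")
  case True
  then have "\<forall>q\<in>A. v q = 0" using sum_nonneg_eq_0_iff[of A v] assms by auto
  then show ?thesis by (simp add: split_entropy_def)
next
  case False
  then have s: "sum v A > 0" using sum_nonneg[of A v] nn by fastforce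
  then have c: "card A > 0" using assms False by (auto simp: card_gt_0_iff)
  have "split_entropy v A \<le> (\<Sum>q\<in>A. v q * ln (card A) + (sum v A / card A - v q))"
    unfolding split_entropy_alt using s c nn by (intro sum_mono gibbs_term) auto
  also have "\<dots> = sum v A * ln (card A)"
    using c by (simp add: sum.distrib sum_subtractf flip: sum_distrib_right)
  finally show ?thesis .
qed

text \<open>
Concavity of entropy. Both vectors are compared with the proportions of their sum by Gibbs' inequality,
with \<open>t\<close> the inverse of the proportion of \<open>q\<close> in the sum; the corrections of the two vectors cancel
in every coordinate.
\<close>
lemma split_entropy_add:
  assumes "finite A" and u: "\<And>q. q \<in> A \<Longrightarrow> 0 \<le> u q" and v: "\<And>q. q \<in> A \<Longrightarrow> 0 \<le> v q"
  shows "split_entropy u A + split_entropy v A \<le> split_entropy (\<lambda>q. u q + v q) A"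
proof -
  define U V where "U = sum u A" and "V = sum v A"
  have UV: "U \<ge> 0" "V \<ge> 0" unfolding U_def V_def using u v by (auto intro: sum_nonneg)
  consider "U = 0" | "V = 0" | "U > 0" "V > 0" using UV by fastforce
  then show ?thesis
  proof cases
    case 1
    then have "\<forall>q\<in>A. u q = 0" using sum_nonneg_eq_0_iff[of A u] assms unfolding U_def by auto
    then show ?thesis by (simp add: split_entropy_def)
  next
    case 2
    then have "\<forall>q\<in>A. v q = 0" using sum_nonneg_eq_0_iff[of A v] assms unfolding V_def by auto
    then show ?thesis by (simp add: split_entropy_def)
  next
    case 3
    have S: "(\<Sum>q\<in>A. u q + v q) = U + V" by (simp add: U_def V_def sum.distrib)
    have "u q * (ln U - ln (u q)) + v q * (ln V - ln (v q))
          \<le> (u q + v q) * (ln (U + V) - ln (u q + v q))" if q: "q \<in> A" for q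
    proof (cases "u q + v q = 0")
      case True
      then have "u q = 0" "v q = 0" using u[OF q] v[OF q] by linarith+
      then show ?thesis by simp
    next
      case False
      (* the inverse of the proportion of q in the sum of the two vectors *)
      define t where "t = (U + V) / (u q + v q)"
      have pos: "u q + v q > 0" using False u[OF q] v[OF q] by linarith
      have t: "t > 0" using 3 pos by (simp add: t_def)
      have lt: "ln t = ln (U + V) - ln (u q + v q)" using 3 pos by (simp add: t_def ln_div)
      have "(U + V) / t = u q + v q" using 3 pos by (simp add: t_def)
      then have "U / t + V / t = u q + v q" by (simp add: add_divide_distrib)
      then show ?thesis
        using gibbs_term[OF u[OF q] 3(1) t] gibbs_term[OF v[OF q] 3(2) t]
        unfolding lt by (simp add: algebra_simps)
    qed
    then show ?thesis
      unfolding split_entropy_alt S U_def[symmetric] V_def[symmetric] sum.distrib[symmetric]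
      by (intro sum_mono)
  qed
qed

lemma split_entropy_sum:
  assumes "finite A" "finite I" "\<And>i q. i \<in> I \<Longrightarrow> q \<in> A \<Longrightarrow> 0 \<le> v i q"
  shows "(\<Sum>i\<in>I. split_entropy (v i) A) \<le> split_entropy (\<lambda>q. \<Sum>i\<in>I. v i q) A"
  using assms(2,3)
proof (induction I rule: finite_induct)
  case empty
  then show ?case by (simp add: split_entropy_def)
next
  case (insert i I)
  have "(\<Sum>j\<in>insert i I. split_entropy (v j) A)
        \<le> split_entropy (v i) A + split_entropy (\<lambda>q. \<Sum>j\<in>I. v j q) A"
    using insert by auto
  also have "\<dots> \<le> split_entropy (\<lambda>q. v i q + (\<Sum>j\<in>I. v j q)) A"
    by (rule split_entropy_add[OF assms(1)]) (auto intro!: sum_nonneg insert.prems)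
  finally show ?case using insert by simp
qed

text \<open>
Superadditivity together with nonnegativity of the entropy of the difference.
\<close>
lemma split_entropy_mono:
  assumes "finite A" "\<And>q. q \<in> A \<Longrightarrow> 0 \<le> u q" "\<And>q. q \<in> A \<Longrightarrow> u q \<le> v q"
  shows "split_entropy u A \<le> split_entropy v A"
proof -
  have "split_entropy u A \<le> split_entropy u A + split_entropy (\<lambda>q. v q - u q) A"
    using split_entropy_nonneg[of A "\<lambda>q. v q - u q"] assms by auto
  also have "\<dots> \<le> split_entropy (\<lambda>q. u q + (v q - u q)) A"
    using assms by (intro split_entropy_add) auto
  finally show ?thesis by simp
qed

section \<open>Comparing the entropies of two partitions\<close>

lemma (in finite_measure) measure_decompose:
  assumes "finite J" "disjoint_family_on B J" "\<And>j. j \<in> J \<Longrightarrow> B j \<in> sets M"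
    and "A \<in> sets M" "A \<subseteq> (\<Union>j\<in>J. B j)"
  shows "measure M A = (\<Sum>j\<in>J. measure M (A \<inter> B j))"
proof -
  have "measure M A = measure M (\<Union>j\<in>J. A \<inter> B j)"
    using assms(5) by (intro arg_cong[where f = "measure M"]) auto
  also have "\<dots> = (\<Sum>j\<in>J. measure M (A \<inter> B j))"
    using assms by (intro finite_measure_finite_Union) (auto simp: disjoint_family_on_def)
  finally show ?thesis .
qed

text \<open>
The entropy of \<open>A\<close> is at most that of the common refinement of \<open>A\<close> and \<open>B\<close>. The cells of \<open>B\<close> outside \<open>K\<close> are
not divided by \<open>A\<close>, and each cell in \<open>K\<close> is divided into at most \<open>card I\<close> pieces. The exceptional set \<open>K\<close>
collects names that have not yet seen enough returns to determine a cell of \<open>A\<close>.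
\<close>
lemma (in finite_measure) entropy_le_refinement:
  assumes I: "finite I" "disjoint_family_on A I" "\<And>i. i \<in> I \<Longrightarrow> A i \<in> sets M"
    and J: "finite J" "disjoint_family_on B J" "\<And>j. j \<in> J \<Longrightarrow> B j \<in> sets M"
    and cover: "(\<Union>i\<in>I. A i) = (\<Union>j\<in>J. B j)"
    and "K \<subseteq> J"
    and refines: "\<And>j. j \<in> J - K \<Longrightarrow> B j = {} \<or> (\<exists>i\<in>I. B j \<subseteq> A i)"
  shows "(\<Sum>i\<in>I. eta (measure M (A i)))
         \<le> (\<Sum>j\<in>J. eta (measure M (B j))) + (\<Sum>j\<in>K. measure M (B j)) * ln (card I)"
proof -
  have Bd: "measure M (B j) = (\<Sum>i\<in>I. measure M (A i \<inter> B j))" if "j \<in> J" for j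
    using measure_decompose[OF I, of "B j"] that J cover by (auto simp: Int_commute)
  have "(\<Sum>i\<in>I. eta (measure M (A i))) = (\<Sum>i\<in>I. eta (\<Sum>j\<in>J. measure M (A i \<inter> B j)))"
    using I cover by (intro sum.cong refl arg_cong[where f = eta] measure_decompose[OF J]) auto
  also have "\<dots> \<le> (\<Sum>i\<in>I. \<Sum>j\<in>J. eta (measure M (A i \<inter> B j)))"
    using J by (intro sum_mono eta_sum_le) auto
  also have "\<dots> = (\<Sum>j\<in>J. \<Sum>i\<in>I. eta (measure M (A i \<inter> B j)))"
    by (rule sum.swap)
  also have "\<dots> = (\<Sum>j\<in>J. eta (measure M (B j)) + split_entropy (\<lambda>i. measure M (A i \<inter> B j)) I)"
    using Bd by (intro sum.cong) (auto simp: split_entropy_def)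
  also have "\<dots> \<le> (\<Sum>j\<in>J. eta (measure M (B j)) + (if j \<in> K then measure M (B j) * ln (card I) else 0))"
  proof (intro sum_mono add_left_mono)
    fix j assume j: "j \<in> J"
    show "split_entropy (\<lambda>i. measure M (A i \<inter> B j)) I
          \<le> (if j \<in> K then measure M (B j) * ln (card I) else 0)"
    proof (cases "j \<in> K")
      case True
      then show ?thesis
        using split_entropy_le_card[OF I(1), of "\<lambda>i. measure M (A i \<inter> B j)"] Bd[OF j] by simp
    next
      case False
      with refines[of j] j consider "B j = {}" | i0 where "i0 \<in> I" "B j \<subseteq> A i0" by blast
      then show ?thesis
      proof cases
        case 1
        then show ?thesis using False by (simp add: split_entropy_def)
      next
        case 2
        have *: "A i \<inter> B j = (if i = i0 then B j else {})" if "i \<in> I" for i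
          using 2 that I(2) by (auto simp: disjoint_family_on_def)
        have "split_entropy (\<lambda>i. measure M (A i \<inter> B j)) I
              = (\<Sum>i\<in>I. if i = i0 then eta (measure M (B j)) else 0) - eta (measure M (B j))"
          unfolding split_entropy_def Bd[OF j, symmetric]
          by (intro arg_cong2[where f = minus] sum.cong refl) (auto simp: *)
        then show ?thesis using False 2 I(1) by simp
      qed
    qed
  qed
  also have "\<dots> = (\<Sum>j\<in>J. eta (measure M (B j))) + (\<Sum>j\<in>K. measure M (B j)) * ln (card I)"
    using J(1) \<open>K \<subseteq> J\<close>
    by (simp add: sum.distrib sum.If_cases Int_absorb1 sum_distrib_right)
  finally show ?thesis .
qed

section \<open>Words of a finite partition\<close>

definition words :: "'b set \<Rightarrow> nat \<Rightarrow> 'b list set" where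
  "words Q n = {w. set w \<subseteq> Q \<and> length w = n}"

lemma finite_words [simp]: "finite Q \<Longrightarrow> finite (words Q n)"
  by (simp add: words_def finite_lists_length_eq)

lemma words_0 [simp]: "words Q 0 = {[]}"
  by (auto simp: words_def)

lemma words_Suc_Cons: "words Q (Suc n) = (\<lambda>(q, w). q # w) ` (Q \<times> words Q n)"
  by (force simp: words_def length_Suc_conv image_iff)

lemma words_Suc_snoc: "words Q (Suc n) = (\<lambda>(w, q). w @ [q]) ` (words Q n \<times> Q)"
  by (force simp: words_def length_Suc_conv_rev image_iff)

lemma sum_words_Cons:
  "(\<Sum>w\<in>words Q (Suc n). f w) = (\<Sum>w\<in>words Q n. \<Sum>q\<in>Q. f (q # w))"
proof -
  have "(\<Sum>w\<in>words Q (Suc n). f w) = (\<Sum>(q, w)\<in>Q \<times> words Q n. f (q # w))"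
    unfolding words_Suc_Cons by (subst sum.reindex) (auto simp: inj_on_def case_prod_unfold)
  then show ?thesis by (simp add: sum.swap[of _ Q] flip: sum.cartesian_product)
qed

lemma sum_words_snoc:
  "(\<Sum>w\<in>words Q (Suc n). f w) = (\<Sum>w\<in>words Q n. \<Sum>q\<in>Q. f (w @ [q]))"
proof -
  have "(\<Sum>w\<in>words Q (Suc n). f w) = (\<Sum>(w, q)\<in>words Q n \<times> Q. f (w @ [q]))"
    unfolding words_Suc_snoc by (subst sum.reindex) (auto simp: inj_on_def case_prod_unfold)
  then show ?thesis by (simp flip: sum.cartesian_product)
qed

text \<open>
If the masses \<open>f (w @ [q])\<close> add up to \<open>f w\<close>, this is the entropy of the letter after \<open>w\<close>, weighted by the mass of \<open>w\<close>.
It is written as a difference because this is the form that telescopes along a tree of words.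
\<close>
definition next_entropy :: "'b set \<Rightarrow> ('b list \<Rightarrow> real) \<Rightarrow> 'b list \<Rightarrow> real" where
  "next_entropy Q f w = (\<Sum>q\<in>Q. eta (f (w @ [q]))) - eta (f w)"

lemma next_entropy_split:
  assumes "f w = (\<Sum>q\<in>Q. f (w @ [q]))"
  shows "next_entropy Q f w = split_entropy (\<lambda>q. f (w @ [q])) Q"
  using assms by (simp add: next_entropy_def split_entropy_def)

section \<open>The process generated by a finite partition\<close>

locale mp_system = prob_space M for M :: "'a measure" +
  fixes T :: "'a \<Rightarrow> 'a"
  assumes preserving: "measure_preserving_map M T"
begin

lemma T_measurable: "T \<in> measurable M M"
  using preserving by (simp add: measure_preserving_map_def)

lemma funpow_measurable [measurable]: "(T ^^ n) \<in> measurable M M"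
  by (induction n) (auto intro: measurable_compose[OF _ T_measurable])

lemma funpow_space: "x \<in> space M \<Longrightarrow> (T ^^ n) x \<in> space M"
  by (rule measurable_space[OF funpow_measurable])

lemma measure_vimage: "A \<in> sets M \<Longrightarrow> measure M (T -` A \<inter> space M) = measure M A"
  using preserving by (simp add: measure_preserving_map_def measure_def)

lemma measure_vimage_funpow:
  "A \<in> sets M \<Longrightarrow> measure M ((T ^^ n) -` A \<inter> space M) = measure M A"
proof (induction n)
  case 0
  then show ?case using sets.sets_into_space by (auto simp: Int_absorb2)
next
  case (Suc n)
  have "(T ^^ Suc n) -` A \<inter> space M = T -` ((T ^^ n) -` A \<inter> space M) \<inter> space M"
    using funpow_space[of _ 1] by (auto simp: funpow_swap1)
  then have "measure M ((T ^^ Suc n) -` A \<inter> space M)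
      = measure M (T -` ((T ^^ n) -` A \<inter> space M) \<inter> space M)"
    by (simp only:)
  also have "\<dots> = measure M ((T ^^ n) -` A \<inter> space M)"
    using Suc.prems by (intro measure_vimage measurable_sets[OF funpow_measurable])
  finally show ?case using Suc by (simp only:)
qed

end

locale finite_process = mp_system M T for M :: "'a measure" and T +
  fixes Q :: "'a set set"
  assumes partition: "finite_measurable_partition M Q"
begin

lemma finite_Q [simp]: "finite Q"
  and Q_sets: "q \<in> Q \<Longrightarrow> q \<in> sets M"
  and partition_Q: "partition_on (space M) Q"
  using partition by (auto simp: finite_measurable_partition_def)

lemma Q_ex1: "x \<in> space M \<Longrightarrow> \<exists>!q. q \<in> Q \<and> x \<in> q"
proof -
  assume "x \<in> space M"
  then obtain q where q: "q \<in> Q" "x \<in> q"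
    using partition_onD1[OF partition_Q] by auto
  then show ?thesis
    using disjointD[OF partition_onD2[OF partition_Q]] by (intro ex1I[of _ q]) auto
qed

lemma Q_nonempty: "Q \<noteq> {}"
  using partition_Q not_empty by (auto simp: partition_on_def)

text \<open>
The letter of a point. Together with \<open>name\<close> below it turns statements about cylinders into statements about lists.
\<close>
definition cell :: "'a \<Rightarrow> 'a set" where
  "cell x = (THE q. q \<in> Q \<and> x \<in> q)"

lemma cell_in: "x \<in> space M \<Longrightarrow> cell x \<in> Q" "x \<in> space M \<Longrightarrow> x \<in> cell x"
  using theI'[OF Q_ex1] by (auto simp: cell_def)

lemma cell_eq: "x \<in> space M \<Longrightarrow> q \<in> Q \<Longrightarrow> x \<in> q \<longleftrightarrow> cell x = q"
  using Q_ex1[of x] cell_in[of x] by auto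

definition name :: "nat \<Rightarrow> 'a \<Rightarrow> 'a set list" where
  "name n x = map (\<lambda>j. cell ((T ^^ j) x)) [0..<n]"

lemma length_name [simp]: "length (name n x) = n"
  by (simp add: name_def)

lemma nth_name [simp]: "j < n \<Longrightarrow> name n x ! j = cell ((T ^^ j) x)"
  by (simp add: name_def)

lemma name_0 [simp]: "name 0 x = []"
  by (simp add: name_def)

lemma name_in_words: "x \<in> space M \<Longrightarrow> name n x \<in> words Q n"
  by (auto simp: name_def words_def intro!: cell_in funpow_space)

lemma name_Suc_snoc: "name (Suc n) x = name n x @ [cell ((T ^^ n) x)]"
  by (simp add: name_def)

lemma name_add: "name (m + n) x = name m x @ name n ((T ^^ m) x)"
  by (rule nth_equalityI) (auto simp: nth_append funpow_add[symmetric, THEN fun_cong, unfolded o_def] simp del: funpow.simps)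

lemma name_Suc_Cons: "name (Suc n) x = cell x # name n (T x)"
  using name_add[of 1 n x] by (simp add: name_def)

definition cyl :: "'a set list \<Rightarrow> 'a set" where
  "cyl w = {x \<in> space M. \<forall>j<length w. (T ^^ j) x \<in> w ! j}"

lemma mem_cyl: "set w \<subseteq> Q \<Longrightarrow> x \<in> cyl w \<longleftrightarrow> x \<in> space M \<and> name (length w) x = w"
proof -
  assume w: "set w \<subseteq> Q"
  have "(\<forall>j<length w. (T ^^ j) x \<in> w ! j) \<longleftrightarrow> name (length w) x = w" if "x \<in> space M"
  proof -
    have "(T ^^ j) x \<in> w ! j \<longleftrightarrow> cell ((T ^^ j) x) = w ! j" if "j < length w" for j
      using cell_eq[OF funpow_space[OF \<open>x \<in> space M\<close>], of "w ! j" j] w that nth_mem by blast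
    then show ?thesis by (auto simp: list_eq_iff_nth_eq)
  qed
  then show ?thesis by (auto simp: cyl_def)
qed

lemma disjoint_cyl: "disjoint_family_on cyl (words Q n)"
  by (auto simp: disjoint_family_on_def words_def mem_cyl)

lemma Union_cyl: "(\<Union>w\<in>words Q n. cyl w) = space M"
proof
  show "(\<Union>w\<in>words Q n. cyl w) \<subseteq> space M" by (auto simp: cyl_def)
  show "space M \<subseteq> (\<Union>w\<in>words Q n. cyl w)"
  proof
    fix x assume x: "x \<in> space M"
    then have "name n x \<in> words Q n" by (rule name_in_words)
    moreover from this x have "x \<in> cyl (name n x)" by (auto simp: mem_cyl words_def)
    ultimately show "x \<in> (\<Union>w\<in>words Q n. cyl w)" by blast
  qed
qed

lemma cyl_sets: "set w \<subseteq> Q \<Longrightarrow> cyl w \<in> sets M"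
proof -
  assume w: "set w \<subseteq> Q"
  have "{x \<in> space M. (T ^^ j) x \<in> w ! j} \<in> sets M" if "j \<in> {..<length w}" for j
  proof -
    have "w ! j \<in> sets M" using w that by (meson Q_sets lessThan_iff nth_mem subsetD)
    from measurable_sets[OF funpow_measurable this] show ?thesis
      by (simp add: vimage_def Int_def conj_commute)
  qed
  then have "{x \<in> space M. \<forall>j\<in>{..<length w}. (T ^^ j) x \<in> w ! j} \<in> sets M"
    by (rule sets.sets_Collect_finite_All) auto
  then show ?thesis by (simp only: cyl_def Ball_def lessThan_iff)
qed

definition p :: "'a set list \<Rightarrow> real" where
  "p w = measure M (cyl w)"

lemma p_nonneg [simp]: "0 \<le> p w"
  by (simp add: p_def)

lemma p_Nil: "p [] = 1"
  by (simp add: p_def cyl_def prob_space)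

lemma sum_p:
  assumes "W \<subseteq> words Q n"
  shows "(\<Sum>w\<in>W. p w) = measure M {x \<in> space M. name n x \<in> W}"
proof -
  have f: "finite W" using assms finite_subset by fastforce
  have *: "x \<in> cyl w \<longleftrightarrow> x \<in> space M \<and> name n x = w" if "w \<in> W" for x w
    using mem_cyl[of w] assms that by (auto simp: words_def)
  have "measure M (\<Union>w\<in>W. cyl w) = (\<Sum>w\<in>W. p w)"
    unfolding p_def using f assms * cyl_sets
    by (intro finite_measure_finite_Union) (auto simp: disjoint_family_on_def words_def)
  moreover have "(\<Union>w\<in>W. cyl w) = {x \<in> space M. name n x \<in> W}" using * by auto
  ultimately show ?thesis by simp
qed

lemma p_snoc: "set w \<subseteq> Q \<Longrightarrow> p w = (\<Sum>q\<in>Q. p (w @ [q]))"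
proof -
  assume w: "set w \<subseteq> Q"
  have d: "disjoint_family_on (\<lambda>q. cyl (w @ [q])) Q"
    using w by (auto simp: disjoint_family_on_def mem_cyl name_Suc_snoc)
  have u: "cyl w = (\<Union>q\<in>Q. cyl (w @ [q]))"
    using w by (auto simp: mem_cyl name_Suc_snoc intro!: cell_in funpow_space)
  show ?thesis unfolding p_def u
    using d w by (intro finite_measure_finite_Union) (auto intro!: cyl_sets)
qed

text \<open>
Stationarity: the cylinders of the words \<open>q # w\<close> partition the preimage of the cylinder of \<open>w\<close> under \<open>T\<close>.
\<close>
lemma p_Cons: "set w \<subseteq> Q \<Longrightarrow> p w = (\<Sum>q\<in>Q. p (q # w))"
proof -
  assume w: "set w \<subseteq> Q"
  have d: "disjoint_family_on (\<lambda>q. cyl (q # w)) Q"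
    using w by (auto simp: disjoint_family_on_def mem_cyl name_Suc_Cons)
  have Ts: "T x \<in> space M" if "x \<in> space M" for x using funpow_space[OF that, of 1] by simp
  have u: "T -` cyl w \<inter> space M = (\<Union>q\<in>Q. cyl (q # w))"
    using w by (auto simp: mem_cyl name_Suc_Cons Ts intro!: cell_in)
  have "p w = measure M (T -` cyl w \<inter> space M)"
    unfolding p_def by (rule measure_vimage[symmetric]) (rule cyl_sets[OF w])
  also have "\<dots> = (\<Sum>q\<in>Q. p (q # w))"
    unfolding p_def u using d w by (intro finite_measure_finite_Union) (auto intro!: cyl_sets)
  finally show ?thesis .
qed

abbreviation J :: "'a set list \<Rightarrow> real" where "J \<equiv> next_entropy Q p"

lemma J_split: "set w \<subseteq> Q \<Longrightarrow> J w = split_entropy (\<lambda>q. p (w @ [q])) Q"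
  by (rule next_entropy_split) (rule p_snoc)

lemma J_nonneg: "set w \<subseteq> Q \<Longrightarrow> 0 \<le> J w"
  by (simp add: J_split split_entropy_nonneg)

lemma J_le_card: "set w \<subseteq> Q \<Longrightarrow> J w \<le> p w * ln (card Q)"
  using split_entropy_le_card[of Q "\<lambda>q. p (w @ [q])"] by (simp add: J_split p_snoc[symmetric])

text \<open>
A longer past leaves less uncertainty about the next letter. The vector of masses after \<open>w\<close> is, by stationarity, the
sum over \<open>q\<close> of the vectors after \<open>q # w\<close>, and the entropy of a vector of masses is superadditive.
\<close>
lemma J_Cons: "set w \<subseteq> Q \<Longrightarrow> (\<Sum>q\<in>Q. J (q # w)) \<le> J w"
proof -
  assume w: "set w \<subseteq> Q"
  have "(\<Sum>q\<in>Q. J (q # w)) = (\<Sum>q\<in>Q. split_entropy (\<lambda>r. p (q # (w @ [r]))) Q)"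
    using w by (intro sum.cong refl) (simp add: J_split)
  also have "\<dots> \<le> split_entropy (\<lambda>r. \<Sum>q\<in>Q. p (q # (w @ [r]))) Q"
    by (intro split_entropy_sum) auto
  also have "\<dots> = split_entropy (\<lambda>r. p (w @ [r])) Q"
    unfolding split_entropy_def using w by (simp add: p_Cons[of "w @ [_]"])
  finally show ?thesis using w by (simp add: J_split)
qed

definition H :: "nat \<Rightarrow> real" where
  "H n = (\<Sum>w\<in>words Q n. eta (p w))"

definition G :: "nat \<Rightarrow> real" where
  "G n = (\<Sum>w\<in>words Q n. J w)"

lemma H_0 [simp]: "H 0 = 0"
  by (simp add: H_def p_Nil eta_def)

lemma G_eq_diff: "G n = H (Suc n) - H n"
  by (simp add: G_def H_def next_entropy_def sum_words_snoc sum_subtractf)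

lemma G_nonneg: "0 \<le> G n"
  unfolding G_def by (intro sum_nonneg J_nonneg) (auto simp: words_def)

lemma G_Suc_le: "G (Suc n) \<le> G n"
  unfolding G_def sum_words_Cons by (intro sum_mono J_Cons) (auto simp: words_def)

lemma G_antimono: "m \<le> n \<Longrightarrow> G n \<le> G m"
  by (rule lift_Suc_antimono_le[of G]) (rule G_Suc_le)

lemma H_sum_G: "H n = (\<Sum>i<n. G i)"
  by (induction n) (simp_all add: G_eq_diff)

text \<open>
The cells of the iterated join are the cylinders of words. Different words may have the same cylinder only
if it is empty, and then it contributes nothing.
\<close>
lemma partition_entropy_iterated_join:
  "partition_entropy M (iterated_join M T Q n) = H n"
proof -
  have ij: "iterated_join M T Q n = cyl ` words Q n"
  proof (intro set_eqI iffI)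
    fix A assume "A \<in> iterated_join M T Q n"
    then obtain f where f: "\<forall>j<n. f j \<in> Q" "A = {x \<in> space M. \<forall>j<n. (T ^^ j) x \<in> f j}"
      unfolding iterated_join_def by blast
    then show "A \<in> cyl ` words Q n"
      by (intro image_eqI[where x = "map f [0..<n]"]) (auto simp: cyl_def words_def)
  next
    fix A assume "A \<in> cyl ` words Q n"
    then obtain w where w: "w \<in> words Q n" "A = cyl w" by blast
    then show "A \<in> iterated_join M T Q n"
      unfolding iterated_join_def
      by (intro CollectI exI[of _ "\<lambda>j. w ! j"]) (auto simp: cyl_def words_def)
  qed
  have "(\<Sum>A\<in>cyl ` words Q n. eta (measure M A))
        = (\<Sum>A\<in>cyl ` {w \<in> words Q n. cyl w \<noteq> {}}. eta (measure M A))"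
    by (rule sum.mono_neutral_right) auto
  also have "\<dots> = (\<Sum>w\<in>{w \<in> words Q n. cyl w \<noteq> {}}. eta (p w))"
  proof (subst sum.reindex)
    show "inj_on cyl {w \<in> words Q n. cyl w \<noteq> {}}"
    proof (rule inj_onI, clarsimp)
      fix v w assume *: "v \<in> words Q n" "w \<in> words Q n" "cyl v = cyl w" "cyl w \<noteq> {}"
      then obtain x where x: "x \<in> cyl v" "x \<in> cyl w" by blast
      have "name n x = v" "name n x = w"
        using x *(1,2) mem_cyl[of v x] mem_cyl[of w x] by (auto simp: words_def)
      then show "v = w" by simp
    qed
  qed (simp add: p_def)
  also have "\<dots> = H n"
    unfolding H_def by (rule sum.mono_neutral_left) (auto simp: p_def)
  finally show ?thesis
    unfolding partition_entropy_def ij by (simp add: eta_def sum_negf)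
qed

lemma entropy_rate_decreasing: "n > 0 \<Longrightarrow> H (Suc n) / Suc n \<le> H n / n"
proof -
  assume n: "n > 0"
  have "real n * G n = (\<Sum>i<n. G n)" by simp
  also have "\<dots> \<le> H n" unfolding H_sum_G by (intro sum_mono G_antimono) auto
  finally show ?thesis using n G_eq_diff[of n] by (simp add: field_simps)
qed

text \<open>
The increments \<open>G\<close> of \<open>H\<close> decrease, so the averages \<open>H n / n\<close> decrease as well. This makes the limit in the definition
of the entropy exist.
\<close>
lemma entropy_tendsto: "(\<lambda>n. H n / n) \<longlonglongrightarrow> entropy_wrt M T Q"
proof -
  have "decseq (\<lambda>n. H (Suc n) / Suc n)"
    by (intro decseq_SucI entropy_rate_decreasing) simp
  moreover have nn: "0 \<le> H n / n" for n
    unfolding H_sum_G by (intro divide_nonneg_nonneg sum_nonneg G_nonneg) auto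
  ultimately obtain L where "(\<lambda>n. H (Suc n) / Suc n) \<longlonglongrightarrow> L"
    using decseq_convergent[of "\<lambda>n. H (Suc n) / Suc n" 0] by blast
  then have "(\<lambda>n. H n / n) \<longlonglongrightarrow> L" by (rule LIMSEQ_imp_Suc)
  then show ?thesis
    unfolding entropy_wrt_def partition_entropy_iterated_join by (simp add: limI)
qed

lemma entropy_wrt_le_G: "entropy_wrt M T Q \<le> G k"
proof (rule LIMSEQ_le[OF entropy_tendsto])
  have "(\<lambda>n. (H k - real k * G k) / n + G k) \<longlonglongrightarrow> 0 + G k"
    by (intro tendsto_add lim_const_over_n tendsto_const)
  then show "(\<lambda>n. (H k - real k * G k) / n + G k) \<longlonglongrightarrow> G k" by simp
  have "H n / n \<le> (H k - real k * G k) / n + G k" if "n \<ge> max 1 k" for n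
  proof -
    have "H n = H k + (\<Sum>i=k..<n. G i)"
      unfolding H_sum_G using that
      by (metis atLeast0LessThan max.bounded_iff sum.atLeastLessThan_concat zero_le)
    also have "(\<Sum>i=k..<n. G i) \<le> (\<Sum>i=k..<n. G k)" by (intro sum_mono G_antimono) auto
    also have "\<dots> = (real n - real k) * G k" using that by (simp add: of_nat_diff)
    finally show ?thesis using that by (simp add: field_simps)
  qed
  then show "\<exists>N. \<forall>n\<ge>N. H n / n \<le> (H k - real k * G k) / n + G k" by blast
qed

end

section \<open>Counting visits in words\<close>

lemma sum_filter_split:
  "finite A \<Longrightarrow> sum f A = sum f {x \<in> A. P x} + sum f {x \<in> A. \<not> P x}"
  by (subst sum.union_disjoint[symmetric]) (auto intro!: sum.cong)

text \<open>
Here and below \<open>D\<close> is the set of letters that stand for visits to \<open>E\<close>.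
\<close>
definition visits :: "'b set \<Rightarrow> 'b list \<Rightarrow> nat" where
  "visits D w = length (filter (\<lambda>q. q \<in> D) w)"

lemma visits_simps [simp]:
  "visits D [] = 0"
  "visits D (q # w) = (if q \<in> D then Suc (visits D w) else visits D w)"
  "visits D (v @ w) = visits D v + visits D w"
  by (simp_all add: visits_def)

lemma visits_le_length: "visits D w \<le> length w"
  by (simp add: visits_def)

text \<open>
The possible pasts back to the \<open>(i + 1)\<close>-st most recent visit, as far as that visit lies within the last \<open>K\<close>
steps. \<open>rare_words\<close> are the pasts of length \<open>K\<close> for which it does not.
\<close>
definition recent_words :: "'b set \<Rightarrow> 'b set \<Rightarrow> nat \<Rightarrow> nat \<Rightarrow> 'b list set" where
  "recent_words Q D i K =
     {w. set w \<subseteq> Q \<and> w \<noteq> [] \<and> length w \<le> K \<and> hd w \<in> D \<and> visits D w = Suc i}"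

definition rare_words :: "'b set \<Rightarrow> 'b set \<Rightarrow> nat \<Rightarrow> nat \<Rightarrow> 'b list set" where
  "rare_words Q D i K = {w \<in> words Q K. visits D w \<le> i}"

lemma finite_bounded_words: "finite Q \<Longrightarrow> finite {w. set w \<subseteq> Q \<and> length w \<le> K}"
  by (rule finite_lists_length_le)

lemma finite_recent_words [simp]: "finite Q \<Longrightarrow> finite (recent_words Q D i K)"
  by (rule finite_subset[OF _ finite_bounded_words[of Q K]]) (auto simp: recent_words_def)

lemma finite_rare_words [simp]: "finite Q \<Longrightarrow> finite (rare_words Q D i K)"
  by (simp add: rare_words_def)

lemma recent_words_Suc:
  "recent_words Q D i (Suc K) = recent_words Q D i K \<union>
     {w \<in> words Q (Suc K). hd w \<in> D \<and> visits D w = Suc i}"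
  by (auto simp: recent_words_def words_def le_Suc_eq)

text \<open>
A recent word of the largest length arises from a rare word that already contains \<open>i\<close> visits, by putting
one more visit in front.
\<close>
lemma recent_words_new:
  "{w \<in> words Q (Suc K). hd w \<in> D \<and> visits D w = Suc i} =
     (\<lambda>(q, w). q # w) ` {(q, w). q \<in> Q \<inter> D \<and> w \<in> words Q K \<and> visits D w = i}"
  by (force simp: words_Suc_Cons)

lemma sum_recent_words_Suc:
  assumes "finite Q"
  shows "(\<Sum>w\<in>recent_words Q D i (Suc K). F w) = (\<Sum>w\<in>recent_words Q D i K. F w) +
     (\<Sum>w\<in>{w \<in> words Q (Suc K). hd w \<in> D \<and> visits D w = Suc i}. F w)"
proof -
  have "recent_words Q D i K \<inter> {w \<in> words Q (Suc K). hd w \<in> D \<and> visits D w = Suc i} = {}"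
    by (auto simp: recent_words_def words_def)
  then show ?thesis unfolding recent_words_Suc using assms by (simp add: sum.union_disjoint)
qed

text \<open>
Recent and rare words together describe every past exactly once. When the window grows by one step, recent words
are kept and every rare word is replaced by its extensions to the left, which are rare or recent; this does not
increase the sum.
\<close>
lemma sum_recent_rare_Suc_le:
  fixes F :: "'b list \<Rightarrow> real"
  assumes Q: "finite Q" and F: "\<And>w. set w \<subseteq> Q \<Longrightarrow> (\<Sum>q\<in>Q. F (q # w)) \<le> F w"
  shows "(\<Sum>w\<in>recent_words Q D i (Suc K). F w) + (\<Sum>w\<in>rare_words Q D i (Suc K). F w)
         \<le> (\<Sum>w\<in>recent_words Q D i K. F w) + (\<Sum>w\<in>rare_words Q D i K. F w)"
proof -
  let ?N = "{w \<in> words Q (Suc K). hd w \<in> D \<and> visits D w = Suc i}"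
  have eq: "?N \<union> rare_words Q D i (Suc K) = (\<lambda>(w, q). q # w) ` (rare_words Q D i K \<times> Q)"
    (is "?L = ?R")
  proof (intro equalityI subsetI)
    fix w assume "w \<in> ?L"
    then obtain q u where "w = q # u" "q \<in> Q" "u \<in> words Q K"
      by (auto simp: rare_words_def words_Suc_Cons)
    with \<open>w \<in> ?L\<close> show "w \<in> ?R"
      by (auto simp: rare_words_def image_iff split: if_splits)
  next
    fix w assume "w \<in> ?R"
    then show "w \<in> ?L" by (auto simp: rare_words_def words_def split: if_splits)
  qed
  have "(\<Sum>w\<in>?N. F w) + (\<Sum>w\<in>rare_words Q D i (Suc K). F w)
        = (\<Sum>w\<in>?N \<union> rare_words Q D i (Suc K). F w)"
    using Q by (intro sum.union_disjoint[symmetric]) (auto simp: rare_words_def)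
  also have "\<dots> = (\<Sum>(w, q)\<in>rare_words Q D i K \<times> Q. F (q # w))"
    unfolding eq by (subst sum.reindex) (auto simp: inj_on_def case_prod_unfold)
  also have "\<dots> = (\<Sum>w\<in>rare_words Q D i K. \<Sum>q\<in>Q. F (q # w))"
    by (simp add: sum.cartesian_product)
  also have "\<dots> \<le> (\<Sum>w\<in>rare_words Q D i K. F w)"
    by (intro sum_mono F) (auto simp: rare_words_def words_def)
  finally show ?thesis by (simp add: sum_recent_words_Suc[OF Q])
qed

lemma sum_recent_rare_antimono:
  fixes F :: "'b list \<Rightarrow> real"
  assumes Q: "finite Q" and F: "\<And>w. set w \<subseteq> Q \<Longrightarrow> (\<Sum>q\<in>Q. F (q # w)) \<le> F w"
    and "L \<le> K"
  shows "(\<Sum>w\<in>recent_words Q D i K. F w) + (\<Sum>w\<in>rare_words Q D i K. F w)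
         \<le> (\<Sum>w\<in>recent_words Q D i L. F w) + (\<Sum>w\<in>rare_words Q D i L. F w)"
  using lift_Suc_antimono_le[of "\<lambda>K. (\<Sum>w\<in>recent_words Q D i K. F w) + (\<Sum>w\<in>rare_words Q D i K. F w)"]
    sum_recent_rare_Suc_le[OF Q F] \<open>L \<le> K\<close> by blast

text \<open>
Every word of length \<open>K\<close> with more than \<open>i\<close> visits has exactly one recent suffix. Hence these words arise from the recent
words by repeated extension to the left.
\<close>
lemma sum_frequent_le_recent:
  fixes F :: "'b list \<Rightarrow> real"
  assumes Q: "finite Q" and F: "\<And>w. set w \<subseteq> Q \<Longrightarrow> (\<Sum>q\<in>Q. F (q # w)) \<le> F w"
  shows "(\<Sum>w\<in>{w \<in> words Q K. i < visits D w}. F w) \<le> (\<Sum>w\<in>recent_words Q D i K. F w)"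
proof (induction K)
  case 0
  have "{w \<in> words Q 0. i < visits D w} = {}" "recent_words Q D i 0 = {}"
    by (auto simp: recent_words_def)
  then show ?case by (simp only: sum.empty order_refl)
next
  case (Suc K)
  let ?N = "{w \<in> words Q (Suc K). hd w \<in> D \<and> visits D w = Suc i}"
  let ?M = "\<lambda>K. {w \<in> words Q K. i < visits D w}"
  let ?R = "(\<lambda>(w, q). q # w) ` (?M K \<times> Q)"
  have eq: "?M (Suc K) = ?N \<union> ?R"
  proof (intro equalityI subsetI)
    fix w assume w: "w \<in> ?M (Suc K)"
    then obtain q u where "w = q # u" "q \<in> Q" "u \<in> words Q K"
      by (auto simp: words_Suc_Cons)
    with w show "w \<in> ?N \<union> ?R" by (force simp: image_iff split: if_splits)
  next
    fix w assume "w \<in> ?N \<union> ?R"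
    then show "w \<in> ?M (Suc K)" by (auto simp: words_def)
  qed
  have "(\<Sum>w\<in>?M (Suc K). F w) = (\<Sum>w\<in>?N. F w) + (\<Sum>w\<in>?R. F w)"
  proof -
    have "?N \<inter> ?R = {}" by (auto simp: recent_words_new)
    then show ?thesis unfolding eq using Q by (simp add: sum.union_disjoint)
  qed
  also have "(\<Sum>w\<in>?R. F w) = (\<Sum>w\<in>?M K. \<Sum>q\<in>Q. F (q # w))"
    by (subst sum.reindex) (auto simp: inj_on_def case_prod_unfold sum.cartesian_product)
  also have "\<dots> \<le> (\<Sum>w\<in>?M K. F w)" by (intro sum_mono F) (auto simp: words_def)
  finally show ?case using Suc by (simp add: sum_recent_words_Suc[OF Q])
qed

section \<open>Names stopped at a return\<close>

text \<open>
Names of points of \<open>E\<close> are followed until the \<open>m\<close>-th return, or until time \<open>K\<close> if that comes first. The word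
of a stopped name has \<open>m + 1\<close> visits, since the starting point is counted, and ends with a visit; an active
name has not reached its \<open>m\<close>-th return.
\<close>
definition active_words :: "'b set \<Rightarrow> 'b set \<Rightarrow> nat \<Rightarrow> nat \<Rightarrow> 'b list set" where
  "active_words Q D m n = {w \<in> words Q n. w \<noteq> [] \<and> hd w \<in> D \<and> visits D w \<le> m}"

definition stopped_words :: "'b set \<Rightarrow> 'b set \<Rightarrow> nat \<Rightarrow> nat \<Rightarrow> 'b list set" where
  "stopped_words Q D m K = {w. set w \<subseteq> Q \<and> w \<noteq> [] \<and> length w \<le> K \<and> hd w \<in> D \<and>
     last w \<in> D \<and> visits D w = Suc m}"

lemma finite_active_words [simp]: "finite Q \<Longrightarrow> finite (active_words Q D m n)"
  by (simp add: active_words_def)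

lemma finite_stopped_words [simp]: "finite Q \<Longrightarrow> finite (stopped_words Q D m K)"
  by (rule finite_subset[OF _ finite_bounded_words[of Q K]]) (auto simp: stopped_words_def)

lemma active_stopped_disjoint: "stopped_words Q D m K \<inter> active_words Q D m n = {}"
  by (auto simp: active_words_def stopped_words_def)

lemma stopped_words_1: "m > 0 \<Longrightarrow> stopped_words Q D m (Suc 0) = {}"
proof -
  assume "m > 0"
  have "visits D w \<noteq> Suc m" if "length w \<le> 1" for w
    using visits_le_length[of D w] that \<open>m > 0\<close> by linarith
  then show ?thesis by (auto simp: stopped_words_def)
qed

lemma active_words_1: "m > 0 \<Longrightarrow> active_words Q D m (Suc 0) = (\<lambda>q. [q]) ` (Q \<inter> D)"
  by (auto simp: active_words_def words_def length_Suc_conv)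

text \<open>
One more step of time extends the active names by a letter and leaves the stopped ones alone.
\<close>
lemma leaves_Suc:
  assumes "n > 0"
  shows "stopped_words Q D m (Suc n) \<union> active_words Q D m (Suc n)
         = stopped_words Q D m n \<union> (\<lambda>(w, q). w @ [q]) ` (active_words Q D m n \<times> Q)"
    (is "?L = ?R")
proof (intro equalityI subsetI)
  fix w assume w: "w \<in> ?L"
  show "w \<in> ?R"
  proof (cases "length w = Suc n")
    case True
    then obtain u q where uq: "w = u @ [q]" "length u = n" by (auto simp: length_Suc_conv_rev)
    then have "u \<noteq> []" using assms by auto
    with w uq have "u \<in> active_words Q D m n" "q \<in> Q"
      by (auto simp: active_words_def stopped_words_def words_def split: if_splits)
    then show ?thesis using uq by auto
  next
    case False
    then show ?thesis using w by (auto simp: active_words_def stopped_words_def words_def)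
  qed
next
  fix w assume w: "w \<in> ?R"
  then show "w \<in> ?L"
    by (auto simp: active_words_def stopped_words_def words_def split: if_splits)
qed

lemma sum_leaves_Suc:
  assumes "finite Q" "n > 0"
  shows "(\<Sum>w\<in>stopped_words Q D m (Suc n) \<union> active_words Q D m (Suc n). F w)
         = (\<Sum>w\<in>stopped_words Q D m n. F w) + (\<Sum>w\<in>active_words Q D m n. \<Sum>q\<in>Q. F (w @ [q]))"
proof -
  let ?A = "(\<lambda>(w, q). w @ [q]) ` (active_words Q D m n \<times> Q)"
  have "(\<Sum>w\<in>stopped_words Q D m (Suc n) \<union> active_words Q D m (Suc n). F w)
        = (\<Sum>w\<in>stopped_words Q D m n. F w) + (\<Sum>w\<in>?A. F w)"
  proof -
    have "stopped_words Q D m n \<inter> ?A = {}"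
      by (auto simp: stopped_words_def active_words_def words_def)
    then show ?thesis
      unfolding leaves_Suc[OF assms(2)] using assms(1) by (simp add: sum.union_disjoint)
  qed
  also have "(\<Sum>w\<in>?A. F w) = (\<Sum>w\<in>active_words Q D m n. \<Sum>q\<in>Q. F (w @ [q]))"
    by (subst sum.reindex) (auto simp: inj_on_def case_prod_unfold sum.cartesian_product)
  finally show ?thesis .
qed

text \<open>
The chain rule along a stopped name. The names stopped or active at time \<open>K + 1\<close> are the leaves of a tree
whose inner nodes are the active names of length at most \<open>K\<close>, and the sum over the inner nodes telescopes.
\<close>
lemma chain_rule_stopped:
  assumes "finite Q" "m > 0"
  shows "(\<Sum>w\<in>stopped_words Q D m (Suc K) \<union> active_words Q D m (Suc K). eta (f w))
         = (\<Sum>q\<in>Q \<inter> D. eta (f [q])) + (\<Sum>n=1..K. \<Sum>w\<in>active_words Q D m n. next_entropy Q f w)"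
proof (induction K)
  case 0
  then show ?case
    using assms by (simp add: stopped_words_1 active_words_1 sum.reindex inj_on_def)
next
  case (Suc K)
  have "(\<Sum>w\<in>stopped_words Q D m (Suc (Suc K)) \<union> active_words Q D m (Suc (Suc K)). eta (f w))
    = (\<Sum>w\<in>stopped_words Q D m (Suc K). eta (f w)) + (\<Sum>w\<in>active_words Q D m (Suc K). eta (f w))
      + (\<Sum>w\<in>active_words Q D m (Suc K). next_entropy Q f w)"
    using assms by (simp add: sum_leaves_Suc next_entropy_def sum_subtractf)
  also have "(\<Sum>w\<in>stopped_words Q D m (Suc K). eta (f w)) + (\<Sum>w\<in>active_words Q D m (Suc K). eta (f w))
    = (\<Sum>w\<in>stopped_words Q D m (Suc K) \<union> active_words Q D m (Suc K). eta (f w))"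
    using assms by (intro sum.union_disjoint[symmetric] active_stopped_disjoint) auto
  finally show ?case using Suc by simp
qed

text \<open>
The link between the two clocks: an inner node of the tree of stopped names, sorted by its number of visits instead of
its length, is a recent word.
\<close>
lemma sum_active_eq_recent:
  fixes F :: "'b list \<Rightarrow> real"
  assumes "finite Q"
  shows "(\<Sum>n=1..K. \<Sum>w\<in>active_words Q D m n. F w) = (\<Sum>i<m. \<Sum>w\<in>recent_words Q D i K. F w)"
proof -
  have pos: "visits D w > 0" if "w \<noteq> []" "hd w \<in> D" for w
    using that by (cases w) auto
  have "(\<Sum>n=1..K. \<Sum>w\<in>active_words Q D m n. F w) = (\<Sum>w\<in>(\<Union>n\<in>{1..K}. active_words Q D m n). F w)"
  proof -
    have "active_words Q D m n \<inter> active_words Q D m k = {}" if "n \<noteq> k" for n k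
      using that by (auto simp: active_words_def words_def)
    then show ?thesis using assms by (intro sum.UNION_disjoint[symmetric]) auto
  qed
  also have "(\<Union>n\<in>{1..K}. active_words Q D m n) = (\<Union>i<m. recent_words Q D i K)" (is "?L = ?R")
  proof (intro equalityI subsetI)
    fix w assume w: "w \<in> ?L"
    then have "visits D w > 0" "visits D w \<le> m" using pos by (auto simp: active_words_def)
    with w show "w \<in> ?R"
      by (intro UN_I[of "visits D w - 1"]) (auto simp: active_words_def recent_words_def words_def)
  next
    fix w assume w: "w \<in> ?R"
    then show "w \<in> ?L"
      by (intro UN_I[of "length w"]) (auto simp: active_words_def recent_words_def words_def Suc_le_eq)
  qed
  also have "(\<Sum>w\<in>\<dots>. F w) = (\<Sum>i<m. \<Sum>w\<in>recent_words Q D i K. F w)"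
  proof -
    have "recent_words Q D i K \<inter> recent_words Q D k K = {}" if "i \<noteq> k" for i k
      using that by (auto simp: recent_words_def)
    then show ?thesis using assms by (intro sum.UNION_disjoint) auto
  qed
  finally show ?thesis .
qed

section \<open>Visits to a sweeping set and the induced map\<close>

locale sweeping = mp_system M T for M :: "'a measure" and T +
  fixes E :: "'a set"
  assumes sweeps: "sweeps_out M T E"
begin

lemma E_sets [measurable]: "E \<in> sets M"
  using sweeps by (simp add: sweeps_out_def)

lemma E_space: "x \<in> E \<Longrightarrow> x \<in> space M"
  using sets.sets_into_space[OF E_sets] by auto

definition count :: "nat \<Rightarrow> 'a \<Rightarrow> nat" where
  "count n x = card {j. j < n \<and> (T ^^ j) x \<in> E}"

lemma count_0 [simp]: "count 0 x = 0"
  by (simp add: count_def)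

lemma count_Suc: "count (Suc n) x = (if (T ^^ n) x \<in> E then Suc (count n x) else count n x)"
proof -
  have "{j. j < Suc n \<and> (T ^^ j) x \<in> E} =
     (if (T ^^ n) x \<in> E then insert n {j. j < n \<and> (T ^^ j) x \<in> E} else {j. j < n \<and> (T ^^ j) x \<in> E})"
    by (auto simp: less_Suc_eq)
  then show ?thesis by (simp add: count_def)
qed

lemma count_mono: "m \<le> n \<Longrightarrow> count m x \<le> count n x"
  by (rule lift_Suc_mono_le[of "\<lambda>n. count n x"]) (simp add: count_Suc)

lemma count_add: "count (m + n) x = count m x + count n ((T ^^ m) x)"
  by (induction n) (simp_all add: count_Suc funpow_add add.commute[of m])

lemma count_eq_0_iff: "count n x = 0 \<longleftrightarrow> (\<forall>j<n. (T ^^ j) x \<notin> E)"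
  by (auto simp: count_def)

lemma count_greater_obtain:
  assumes "i < count n x"
  obtains k where "k < n" "(T ^^ k) x \<in> E" "count k x = i"
proof -
  have "\<exists>k<n. (T ^^ k) x \<in> E \<and> count k x = i"
    using assms
  proof (induction n)
    case (Suc n)
    then show ?case
      by (cases "i < count n x") (auto simp: count_Suc less_Suc_eq split: if_splits)
  qed simp
  then show thesis using that by blast
qed

lemma count_measurable [measurable]: "count n \<in> measurable M (count_space UNIV)"
proof (induction n)
  case (Suc n)
  have "{x \<in> space M. (T ^^ n) x \<in> E} \<in> sets M" by measurable
  with Suc show ?case unfolding count_Suc[abs_def] by measurable
qed (simp add: count_def)

definition rare :: "nat \<Rightarrow> nat \<Rightarrow> 'a set" where
  "rare m n = {x \<in> space M. count n x \<le> m}"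

lemma rare_sets [measurable]: "rare m n \<in> sets M"
  unfolding rare_def by measurable

text \<open>
Almost every point visits \<open>E\<close> infinitely often: a point with finitely many visits is mapped by some iterate into the
set of points that never visit \<open>E\<close>, which is null because \<open>E\<close> sweeps out, and preimages of null sets are null.
\<close>
lemma rare_measure_tendsto_0: "(\<lambda>n. measure M (rare m n)) \<longlonglongrightarrow> 0"
proof -
  define Z where "Z = {x \<in> space M. \<forall>n. (T ^^ n) x \<notin> E}"
  have Zs: "Z \<in> sets M" unfolding Z_def by measurable
  have "space M - Z = (\<Union>n. (T ^^ n) -` E \<inter> space M)" by (auto simp: Z_def)
  then have "measure M (space M - Z) = 1"
    using sweeps by (simp add: sweeps_out_def measure_def)
  then have "measure M Z = 0" using prob_compl[OF Zs] by simp
  then have null: "(T ^^ n) -` Z \<inter> space M \<in> null_sets M" for n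
    using measure_vimage_funpow[OF Zs, of n] measurable_sets[OF funpow_measurable Zs]
    by (simp add: null_sets_def emeasure_eq_measure)
  have "(\<Inter>n. rare m n) \<subseteq> (\<Union>n. (T ^^ n) -` Z \<inter> space M)"
  proof
    fix x assume x: "x \<in> (\<Inter>n. rare m n)"
    then have xs: "x \<in> space M" by (auto simp: rare_def)
    have "\<exists>n. \<forall>j. (T ^^ (j + n)) x \<notin> E"
    proof (rule ccontr)
      assume "\<not> ?thesis"
      then have inf: "\<exists>j. (T ^^ (j + n)) x \<in> E" for n by blast
      have "\<exists>n. i < count n x" for i
      proof (induction i)
        case 0
        from inf[of 0] obtain j where "(T ^^ j) x \<in> E" by auto
        then show ?case by (intro exI[of _ "Suc j"]) (simp add: count_Suc)
      next
        case (Suc i)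
        then obtain n where n: "i < count n x" by blast
        from inf[of n] obtain j where "(T ^^ (j + n)) x \<in> E" by auto
        then show ?case
          using n count_mono[of n "j + n" x] by (intro exI[of _ "Suc (j + n)"]) (simp add: count_Suc)
      qed
      then obtain n where "m < count n x" by blast
      then show False using x by (auto simp: rare_def not_le[symmetric])
    qed
    then obtain n where "\<forall>j. (T ^^ (j + n)) x \<notin> E" by blast
    then show "x \<in> (\<Union>n. (T ^^ n) -` Z \<inter> space M)"
      using xs funpow_space by (auto simp: Z_def funpow_add)
  qed
  then have "(\<Inter>n. rare m n) \<in> null_sets M"
  proof (rule null_sets_subset[rotated 2])
    show "(\<Union>n. (T ^^ n) -` Z \<inter> space M) \<in> null_sets M" using null by (rule null_sets_UN)
    show "(\<Inter>n. rare m n) \<in> sets M" by (rule sets.countable_INT) auto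
  qed
  then have "measure M (\<Inter>n. rare m n) = 0" by (simp add: null_sets_def measure_def)
  moreover have "decseq (rare m)"
    using count_mono by (auto simp: decseq_def rare_def intro: order_trans)
  ultimately show ?thesis
    using finite_Lim_measure_decseq[of "rare m"] by (simp add: image_subset_iff)
qed

abbreviation S where "S \<equiv> induced_map T E"
abbreviation N where "N \<equiv> induced_measure M E"

definition first_return :: "nat \<Rightarrow> 'a set \<Rightarrow> 'a set" where
  "first_return k A = {x \<in> E. (\<forall>j\<in>{1..<k}. (T ^^ j) x \<notin> E) \<and> (T ^^ k) x \<in> A}"

lemma first_return_sets [measurable]: "A \<in> sets M \<Longrightarrow> first_return k A \<in> sets M"
proof -
  assume [measurable]: "A \<in> sets M"
  have "first_return k A = {x \<in> space M. x \<in> E \<and> (\<forall>j\<in>{1..<k}. (T ^^ j) x \<notin> E) \<and> (T ^^ k) x \<in> A}"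
    using E_space by (auto simp: first_return_def)
  also have "\<dots> \<in> sets M" by measurable
  finally show ?thesis .
qed

lemma induced_map_first_return:
  assumes "k \<ge> 1" "x \<in> first_return k E"
  shows "S x = (T ^^ k) x"
proof -
  have "return_time T E x = k"
    unfolding return_time_def using assms
    by (intro Least_equality) (auto simp: first_return_def not_less[symmetric])
  then show ?thesis using assms by (auto simp: induced_map_def first_return_def)
qed

lemma first_return_obtain:
  assumes "x \<in> E" "n \<ge> 1" "(T ^^ n) x \<in> E"
  obtains k where "k \<ge> 1" "k \<le> n" "x \<in> first_return k E"
proof -
  define P where "P j \<longleftrightarrow> 1 \<le> j \<and> (T ^^ j) x \<in> E" for j
  define k where "k = (LEAST j. P j)"
  have "P n" using assms by (simp add: P_def)
  then have "P k" "k \<le> n" unfolding k_def by (rule LeastI, rule Least_le)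
  moreover have "\<not> P j" if "j < k" for j
    using that unfolding k_def by (rule not_less_Least)
  ultimately show thesis
    using assms by (intro that[of k]) (simp_all add: first_return_def P_def)
qed

lemma induced_map_in: "x \<in> E \<Longrightarrow> S x \<in> E"
proof (cases "\<exists>n\<ge>1. (T ^^ n) x \<in> E")
  case True
  assume "x \<in> E"
  with True obtain k where "k \<ge> 1" "x \<in> first_return k E" by (metis first_return_obtain)
  then show ?thesis using induced_map_first_return by (auto simp: first_return_def)
qed (auto simp: induced_map_def)

text \<open>
At a visit the two clocks agree: the number of steps of \<open>S\<close> is the number of earlier visits.
\<close>
lemma induced_map_funpow:
  assumes "x \<in> E" "(T ^^ n) x \<in> E"
  shows "(S ^^ count n x) x = (T ^^ n) x"
  using assms
proof (induction n arbitrary: x rule: less_induct)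
  case (less n)
  show ?case
  proof (cases "n = 0")
    case False
    then obtain k where k: "k \<ge> 1" "k \<le> n" "x \<in> first_return k E"
      using first_return_obtain[of x n] less.prems by (metis One_nat_def Suc_leI neq0_conv)
    have Sx: "S x = (T ^^ k) x" by (rule induced_map_first_return[OF k(1,3)])
    have "count k x = 1"
    proof -
      have "{j. j < k \<and> (T ^^ j) x \<in> E} = {0}"
      proof (intro equalityI subsetI)
        fix j assume "j \<in> {j. j < k \<and> (T ^^ j) x \<in> E}"
        then show "j \<in> {0}" using k by (cases "j = 0") (auto simp: first_return_def)
      qed (use k less.prems in auto)
      then show ?thesis by (simp add: count_def)
    qed
    moreover have "n = k + (n - k)" using k by simp
    ultimately have c: "count n x = Suc (count (n - k) (S x))"
      using count_add[of k "n - k" x] by (simp add: Sx)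
    have T: "(T ^^ (n - k)) (S x) = (T ^^ n) x"
      using k unfolding Sx by (metis comp_apply funpow_add le_add_diff_inverse2)
    have "(S ^^ count (n - k) (S x)) (S x) = (T ^^ (n - k)) (S x)"
      using k less.prems T by (intro less.IH induced_map_in) auto
    then show ?thesis by (simp add: c T funpow_swap1)
  qed simp
qed

lemma induced_map_at_visit:
  assumes "x \<in> E" "i < count n x"
  obtains k where "k < n" "(T ^^ k) x \<in> E" "count k x = i" "(S ^^ i) x = (T ^^ k) x"
  using count_greater_obtain[OF assms(2)] induced_map_funpow[OF assms(1)] by metis

text \<open>
Split the preimage of \<open>A\<close> under \<open>T\<close> into the part in \<open>E\<close> and the part outside \<open>E\<close>, pull the latter back once more,
and continue. The part in \<open>E\<close> at step \<open>k\<close> consists of the points that return for the first time at time \<open>k\<close>, and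
arrive in \<open>A\<close>.
\<close>
lemma measure_first_return_decompose:
  assumes A[measurable]: "A \<in> sets M" and "A \<subseteq> E"
  shows "measure M A = (\<Sum>k<n. measure M (first_return (Suc k) A))
    + measure M {x \<in> space M. (\<forall>j\<in>{..<n}. (T ^^ j) x \<notin> E) \<and> (T ^^ n) x \<in> A}"
proof (induction n)
  case 0
  have "{x \<in> space M. x \<in> A} = A" using assms E_space by auto
  then show ?case by simp
next
  case (Suc n)
  (* the points whose first visit to E, counted from time 0 on, takes place at time n and in A *)
  define R where "R = (\<lambda>n. {x \<in> space M. (\<forall>j\<in>{..<n}. (T ^^ j) x \<notin> E) \<and> (T ^^ n) x \<in> A})"
  have Rs: "R n \<in> sets M" for n unfolding R_def by measurable
  have sh: "(T ^^ j) (T x) = (T ^^ Suc j) x" for j x by (simp add: funpow_swap1)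
  have Tsp: "x \<in> space M \<Longrightarrow> T x \<in> space M" for x using funpow_space[of x 1] by simp
  have allSuc: "(\<forall>j\<in>{..<Suc n}. P j) \<longleftrightarrow> P 0 \<and> (\<forall>j\<in>{..<n}. P (Suc j))" for P :: "nat \<Rightarrow> bool"
    by (auto simp: less_Suc_eq_0_disj)
  have all1: "(\<forall>j\<in>{1..<Suc n}. P j) \<longleftrightarrow> (\<forall>j\<in>{..<n}. P (Suc j))" for P :: "nat \<Rightarrow> bool"
    by (metis (no_types, lifting) One_nat_def Suc_less_eq Suc_pred atLeastLessThan_iff lessThan_iff less_eq_Suc_le zero_less_Suc le_add1 plus_1_eq_Suc)
  have "measure M (R n) = measure M (T -` R n \<inter> space M)" by (rule measure_vimage[OF Rs, symmetric])
  also have "T -` R n \<inter> space M = first_return (Suc n) A \<union> R (Suc n)"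
  proof (rule set_eqI)
    fix x
    have "x \<in> T -` R n \<inter> space M \<longleftrightarrow>
        x \<in> space M \<and> (\<forall>j\<in>{..<n}. (T ^^ Suc j) x \<notin> E) \<and> (T ^^ Suc n) x \<in> A"
      using Tsp by (auto simp: R_def sh simp del: funpow.simps)
    moreover have "x \<in> first_return (Suc n) A \<longleftrightarrow>
        x \<in> E \<and> (\<forall>j\<in>{..<n}. (T ^^ Suc j) x \<notin> E) \<and> (T ^^ Suc n) x \<in> A"
      by (simp only: first_return_def mem_Collect_eq all1)
    moreover have "x \<in> R (Suc n) \<longleftrightarrow>
        x \<in> space M \<and> x \<notin> E \<and> (\<forall>j\<in>{..<n}. (T ^^ Suc j) x \<notin> E) \<and> (T ^^ Suc n) x \<in> A"
      by (simp only: R_def mem_Collect_eq allSuc funpow_0) blast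
    ultimately show "x \<in> T -` R n \<inter> space M \<longleftrightarrow> x \<in> first_return (Suc n) A \<union> R (Suc n)"
      using E_space by blast
  qed
  also have "measure M \<dots> = measure M (first_return (Suc n) A) + measure M (R (Suc n))"
    using Rs by (intro finite_measure_Union first_return_sets A)
      (auto simp: first_return_def R_def allSuc simp del: funpow.simps)
  finally show ?case using Suc by (simp add: R_def)
qed

text \<open>
The induced map preserves the measure on \<open>E\<close>. The pieces of the preimage with first return time \<open>k\<close> are
those of the decomposition of \<open>A\<close> above, and the remainder there tends to \<open>0\<close>. The points of \<open>E\<close> that never return, on
which the induced map is the identity, form a null set.
\<close>
lemma measure_induced_vimage:
  assumes A: "A \<in> sets M" "A \<subseteq> E"
  shows "S -` A \<inter> E \<in> sets M" "measure M (S -` A \<inter> E) = measure M A"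
proof -
  define U where "U = (\<Union>k. first_return (Suc k) A)"
  define Z where "Z = {x \<in> E. \<forall>n\<ge>1. (T ^^ n) x \<notin> E}"
  have Us: "U \<in> sets M" unfolding U_def using A by measurable
  have Zs: "Z \<in> sets M"
  proof -
    have "Z = {x \<in> space M. x \<in> E \<and> (\<forall>n\<in>{1..}. (T ^^ n) x \<notin> E)}" using E_space by (auto simp: Z_def)
    also have "\<dots> \<in> sets M" by measurable
    finally show ?thesis .
  qed
  have eq: "S -` A \<inter> E = U \<union> (Z \<inter> A)"
  proof (intro equalityI subsetI)
    fix x assume x: "x \<in> S -` A \<inter> E"
    show "x \<in> U \<union> (Z \<inter> A)"
    proof (cases "\<exists>n\<ge>1. (T ^^ n) x \<in> E")
      case True
      then obtain k where k: "k \<ge> 1" "x \<in> first_return k E" using x by (metis IntD2 first_return_obtain)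
      then have "x \<in> first_return (Suc (k - 1)) A"
        using x induced_map_first_return[OF k] by (auto simp: first_return_def)
      then show ?thesis by (auto simp: U_def)
    next
      case False
      then have "S x = x" unfolding induced_map_def by (simp only: if_False)
      then show ?thesis using x False by (auto simp: Z_def)
    qed
  next
    fix x assume "x \<in> U \<union> (Z \<inter> A)"
    then consider k where "x \<in> first_return (Suc k) A" | "x \<in> Z" "x \<in> A" by (auto simp: U_def)
    then show "x \<in> S -` A \<inter> E"
    proof cases
      case 1
      then have "x \<in> first_return (Suc k) E" using A by (auto simp: first_return_def)
      then have "S x = (T ^^ Suc k) x" by (intro induced_map_first_return) auto
      with 1 show ?thesis by (auto simp: first_return_def simp del: funpow.simps)
    next
      case 2
      then show ?thesis by (auto simp: Z_def induced_map_def)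
    qed
  qed
  show "S -` A \<inter> E \<in> sets M" unfolding eq using Us Zs A by measurable
  have "Z \<subseteq> rare 1 n" for n
  proof
    fix x assume x: "x \<in> Z"
    have "{j. j < n \<and> (T ^^ j) x \<in> E} \<subseteq> {0}"
      using x by (auto simp: Z_def) (metis One_nat_def Suc_leI neq0_conv)
    then have "count n x \<le> 1" unfolding count_def using card_mono[of "{0::nat}"] by fastforce
    then show "x \<in> rare 1 n" using x E_space by (auto simp: rare_def Z_def)
  qed
  then have "measure M Z \<le> measure M (rare 1 n)" for n by (intro finite_measure_mono) auto
  then have "measure M Z \<le> 0"
    by (intro LIMSEQ_le_const[OF rare_measure_tendsto_0[of 1]]) auto
  then have "Z \<in> null_sets M" using Zs by (simp add: null_sets_def emeasure_eq_measure measure_le_0_iff)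
  then have "Z \<inter> A \<in> null_sets M" using A(1) by (rule null_set_Int2)
  then have 1: "measure M (S -` A \<inter> E) = measure M U"
    unfolding eq using Us by (intro measure_Un_null_set)
  have disj: "disjoint_family (\<lambda>k. first_return (Suc k) A)"
  proof -
    have "first_return (Suc k) A \<inter> first_return (Suc l) A = {}" if "k < l" for k l
      using that A by (fastforce simp: first_return_def simp del: funpow.simps)
    then have "first_return (Suc k) A \<inter> first_return (Suc l) A = {}" if "k \<noteq> l" for k l
      using that by (metis inf_commute nat_neq_iff)
    then show ?thesis by (simp add: disjoint_family_on_def)
  qed
  have s: "(\<lambda>n. \<Sum>k<n. measure M (first_return (Suc k) A)) \<longlonglongrightarrow> measure M U"
    unfolding U_def sums_def[symmetric]
    using A by (intro finite_measure_UNION disj) auto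
  define R where "R = (\<lambda>n. {x \<in> space M. (\<forall>j\<in>{..<n}. (T ^^ j) x \<notin> E) \<and> (T ^^ n) x \<in> A})"
  have "measure M (R n) \<le> measure M (rare 0 n)" for n
    by (intro finite_measure_mono) (auto simp: R_def rare_def count_eq_0_iff)
  then have R0: "(\<lambda>n. measure M (R n)) \<longlonglongrightarrow> 0"
    by (intro tendsto_sandwich[OF _ _ tendsto_const rare_measure_tendsto_0[of 0]]) auto
  have "(\<lambda>n. measure M A - measure M (R n)) \<longlonglongrightarrow> measure M A - 0"
    by (intro tendsto_diff tendsto_const R0)
  moreover have "measure M A - measure M (R n) = (\<Sum>k<n. measure M (first_return (Suc k) A))" for n
    using measure_first_return_decompose[OF A, of n] unfolding R_def by linarith
  ultimately have "(\<lambda>n. \<Sum>k<n. measure M (first_return (Suc k) A)) \<longlonglongrightarrow> measure M A"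
    by simp
  with s 1 show "measure M (S -` A \<inter> E) = measure M A"
    using LIMSEQ_unique by metis
qed

lemma measure_E_pos: "measure M E > 0"
proof (rule ccontr)
  assume "\<not> ?thesis"
  then have "measure M E = 0" by (simp add: not_less measure_le_0_iff)
  then have "(T ^^ n) -` E \<inter> space M \<in> null_sets M" for n
    using measure_vimage_funpow[OF E_sets, of n] measurable_sets[OF funpow_measurable E_sets]
    by (simp add: null_sets_def emeasure_eq_measure)
  then have "(\<Union>n. (T ^^ n) -` E \<inter> space M) \<in> null_sets M" by (rule null_sets_UN)
  then show False using sweeps by (simp add: sweeps_out_def null_sets_def)
qed

lemma space_N [simp]: "space N = E"
  using sets.sets_into_space[OF E_sets]
  by (auto simp: induced_measure_def space_scale_measure space_restrict_space)

lemma sets_N_iff: "A \<in> sets N \<longleftrightarrow> A \<in> sets M \<and> A \<subseteq> E"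
  using sets.sets_into_space[OF E_sets]
  by (auto simp: induced_measure_def sets_scale_measure sets_restrict_space_iff Int_absorb2)

lemma emeasure_N: "A \<in> sets N \<Longrightarrow> emeasure N A = 1 / emeasure M E * emeasure M A"
  using sets.sets_into_space[OF E_sets]
  by (simp add: sets_N_iff, subst induced_measure_def)
    (auto simp: Int_absorb2 intro!: arg_cong2[where f = times] emeasure_restrict_space)

lemma measure_N: "A \<in> sets N \<Longrightarrow> measure N A = measure M A / measure M E"
  using measure_E_pos
  by (simp add: measure_def[of N] emeasure_N emeasure_eq_measure divide_ennreal ennreal_mult[symmetric]
      flip: ennreal_1)

lemma prob_space_N: "prob_space N"
proof
  have "emeasure N E = 1"
    using measure_E_pos
    by (simp add: emeasure_N sets_N_iff emeasure_eq_measure divide_ennreal ennreal_mult[symmetric]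
        flip: ennreal_1)
  then show "emeasure N (space N) = 1" by simp
qed

lemma mp_system_N: "mp_system N S"
proof -
  interpret N: prob_space N by (rule prob_space_N)
  have "S \<in> measurable N N"
    using measure_induced_vimage(1) induced_map_in
    by (intro measurableI) (auto simp: sets_N_iff)
  moreover have "emeasure N (S -` A \<inter> space N) = emeasure N A" if "A \<in> sets N" for A
    using that measure_induced_vimage[of A] by (simp add: N.emeasure_eq_measure measure_N sets_N_iff)
  ultimately show ?thesis
    by unfold_locales (simp add: measure_preserving_map_def)
qed

lemma partition_N_process:
  "finite_measurable_partition N P \<Longrightarrow> finite_process N S P"
  using mp_system_N by (simp add: finite_process_def finite_process_axioms_def)

end

section \<open>Processes that see the visits\<close>

text \<open>
That \<open>E\<close> is a union of cells makes visits visible in names.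
\<close>
locale coded_process = sweeping M T E + finite_process M T Q
  for M :: "'a measure" and T E Q +
  assumes E_cells: "q \<in> Q \<Longrightarrow> q \<subseteq> E \<or> q \<inter> E = {}"
begin

definition D :: "'a set set" where
  "D = {q \<in> Q. q \<subseteq> E}"

lemma Q_Int_D [simp]: "Q \<inter> D = D"
  by (auto simp: D_def)

lemma cell_in_D_iff: "x \<in> space M \<Longrightarrow> cell x \<in> D \<longleftrightarrow> x \<in> E"
  using cell_in[of x] E_cells[of "cell x"] by (auto simp: D_def)

lemma visits_name: "x \<in> space M \<Longrightarrow> visits D (name n x) = count n x"
proof -
  assume x: "x \<in> space M"
  have "{i. i < n \<and> name n x ! i \<in> D} = {j. j < n \<and> (T ^^ j) x \<in> E}"
    by (rule Collect_cong, rule conj_cong[OF refl]) (simp add: cell_in_D_iff funpow_space x)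
  then show ?thesis by (simp only: visits_def count_def length_filter_conv_card length_name)
qed

lemma hd_name_in_D_iff: "x \<in> space M \<Longrightarrow> n > 0 \<Longrightarrow> hd (name n x) \<in> D \<longleftrightarrow> x \<in> E"
  using cell_in_D_iff[of x] by (cases n) (simp_all add: name_Suc_Cons)

lemma sum_p_rare_words: "(\<Sum>w\<in>rare_words Q D m n. p w) = measure M (rare m n)"
proof -
  have "{x \<in> space M. name n x \<in> rare_words Q D m n} = rare m n"
    by (auto simp: rare_words_def rare_def visits_name name_in_words)
  then show ?thesis
    using sum_p[of "rare_words Q D m n" n] by (simp add: rare_words_def)
qed

text \<open>
By \<open>leaf_ex1\<close> below, the cylinders of the leaves form a partition of \<open>E\<close>, up to empty cylinders.
\<close>
definition leaves :: "nat \<Rightarrow> nat \<Rightarrow> 'a set list set" where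
  "leaves m n = stopped_words Q D m n \<union> active_words Q D m n"

lemma finite_leaves [simp]: "finite (leaves m n)"
  by (simp add: leaves_def)

lemma leaves_subset: "w \<in> leaves m n \<Longrightarrow> set w \<subseteq> Q" "w \<in> leaves m n \<Longrightarrow> w \<noteq> []"
  by (auto simp: leaves_def stopped_words_def active_words_def words_def)

lemma leaf_cyl_subset: "w \<in> leaves m n \<Longrightarrow> cyl w \<subseteq> E"
proof
  fix x assume w: "w \<in> leaves m n" and x: "x \<in> cyl w"
  have "hd w \<in> D" using w by (auto simp: leaves_def stopped_words_def active_words_def)
  then show "x \<in> E"
    using x w leaves_subset[OF w] hd_name_in_D_iff[of x "length w"] by (auto simp: mem_cyl)
qed

lemma leaf_ex1:
  assumes "m > 0" "x \<in> E"
  shows "\<exists>!w. w \<in> leaves m (Suc n) \<and> x \<in> cyl w"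
proof (induction n)
  case 0
  have x: "x \<in> space M" using assms E_space by auto
  have "leaves m (Suc 0) = (\<lambda>q. [q]) ` D"
    using assms by (simp add: leaves_def stopped_words_1 active_words_1)
  moreover have "x \<in> cyl [q] \<longleftrightarrow> q = cell x" if "q \<in> D" for q
    using that x by (subst mem_cyl) (auto simp: D_def name_Suc_Cons)
  moreover have "cell x \<in> D" using cell_in_D_iff[OF x] assms by simp
  ultimately show ?case by (intro ex1I[of _ "[cell x]"]) auto
next
  case (Suc n)
  have x: "x \<in> space M" using assms E_space by auto
  from Suc obtain w where w: "w \<in> leaves m (Suc n)" "x \<in> cyl w"
    and uniq: "\<And>w'. w' \<in> leaves m (Suc n) \<Longrightarrow> x \<in> cyl w' \<Longrightarrow> w' = w" by blast
  have L: "leaves m (Suc (Suc n)) = stopped_words Q D m (Suc n) \<union>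
     (\<lambda>(w, q). w @ [q]) ` (active_words Q D m (Suc n) \<times> Q)"
    by (simp add: leaves_def leaves_Suc)
  have sub: "set v \<subseteq> Q" if "v \<in> active_words Q D m (Suc n)" for v
    using that by (auto simp: active_words_def words_def)
  have snoc: "x \<in> cyl (v @ [q]) \<longleftrightarrow> x \<in> cyl v \<and> q = cell ((T ^^ length v) x)"
    if "set v \<subseteq> Q" "q \<in> Q" for v q
    using that x by (auto simp: mem_cyl name_Suc_snoc)
  show ?case
  proof (cases "w \<in> stopped_words Q D m (Suc n)")
    case True
    show ?thesis
    proof (rule ex1I[of _ w])
      show "w \<in> leaves m (Suc (Suc n)) \<and> x \<in> cyl w" using True w by (auto simp: L)
      fix w' assume w': "w' \<in> leaves m (Suc (Suc n)) \<and> x \<in> cyl w'"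
      then consider "w' \<in> stopped_words Q D m (Suc n)"
        | v q where "w' = v @ [q]" "v \<in> active_words Q D m (Suc n)" "q \<in> Q"
        by (auto simp: L)
      then show "w' = w"
      proof cases
        case 1
        then show ?thesis using uniq w' by (auto simp: leaves_def)
      next
        case 2
        then have "v = w" using uniq w' snoc sub by (auto simp: leaves_def)
        then show ?thesis using 2 True active_stopped_disjoint by fastforce
      qed
    qed
  next
    case False
    then have wa: "w \<in> active_words Q D m (Suc n)" using w by (auto simp: leaves_def)
    define r where "r = cell ((T ^^ length w) x)"
    have r: "r \<in> Q" unfolding r_def by (intro cell_in funpow_space x)
    show ?thesis
    proof (rule ex1I[of _ "w @ [r]"])
      show "w @ [r] \<in> leaves m (Suc (Suc n)) \<and> x \<in> cyl (w @ [r])"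
        using wa r w snoc[OF sub[OF wa] r] by (auto simp: L r_def)
      fix w' assume w': "w' \<in> leaves m (Suc (Suc n)) \<and> x \<in> cyl w'"
      then consider "w' \<in> stopped_words Q D m (Suc n)"
        | v q where "w' = v @ [q]" "v \<in> active_words Q D m (Suc n)" "q \<in> Q"
        by (auto simp: L)
      then show "w' = w @ [r]"
      proof cases
        case 1
        then have "w' = w" using uniq w' by (auto simp: leaves_def)
        then show ?thesis using 1 False by simp
      next
        case 2
        then have *: "x \<in> cyl v" "q = cell ((T ^^ length v) x)" using w' snoc sub by auto
        then have "v = w" using uniq 2 by (auto simp: leaves_def)
        then show ?thesis using 2 * by (simp add: r_def)
      qed
    qed
  qed
qed

text \<open>
The time of the \<open>i\<close>-th return and the position of that visit can be read off the name, so points with the same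
name make their returns simultaneously.
\<close>
lemma visits_agree:
  assumes x: "x \<in> E" and y: "y \<in> E" and eq: "name n x = name n y" and i: "i < count n x"
  obtains k where "k < n" "count k x = i" "(T ^^ k) x \<in> E" "(S ^^ i) x = (T ^^ k) x"
    "(S ^^ i) y = (T ^^ k) y"
proof -
  obtain k where k: "k < n" "(T ^^ k) x \<in> E" "count k x = i" "(S ^^ i) x = (T ^^ k) x"
    using induced_map_at_visit[OF x i] by metis
  have xs: "x \<in> space M" "y \<in> space M" using x y E_space by auto
  have "name k x = name k y" using eq k(1) by (auto simp: list_eq_iff_nth_eq)
  then have "count k y = i" using visits_name[OF xs(1), of k] visits_name[OF xs(2), of k] k by simp
  moreover have "cell ((T ^^ k) x) = cell ((T ^^ k) y)"
    using eq k(1) nth_name by metis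
  then have "(T ^^ k) y \<in> E"
    using k(2) cell_in_D_iff[OF funpow_space[OF xs(1)]] cell_in_D_iff[OF funpow_space[OF xs(2)]] by metis
  ultimately show thesis using that k induced_map_funpow[OF y] by metis
qed

section \<open>The lower bound for the entropy of the system\<close>

lemma recent_words_short: "K \<le> i \<Longrightarrow> recent_words Q D i K = {}"
proof -
  assume "K \<le> i"
  have "visits D w \<noteq> Suc i" if "length w \<le> K" for w
    using visits_le_length[of D w] that \<open>K \<le> i\<close> by linarith
  then show ?thesis by (auto simp: recent_words_def)
qed

text \<open>
A recent word with \<open>i + 1\<close> visits has more than \<open>i\<close> letters, so it extends a word of length \<open>i\<close> to the left.
For the window of length \<open>i\<close> itself all words are rare.
\<close>
lemma sum_recent_J_le_G: "(\<Sum>w\<in>recent_words Q D i K. J w) \<le> G i"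
proof (cases "K \<le> i")
  case True
  then show ?thesis by (simp add: recent_words_short G_nonneg)
next
  case False
  have "rare_words Q D i i = words Q i"
    using visits_le_length by (auto simp: rare_words_def words_def)
  moreover have "(\<Sum>w\<in>recent_words Q D i K. J w) + (\<Sum>w\<in>rare_words Q D i K. J w)
         \<le> (\<Sum>w\<in>recent_words Q D i i. J w) + (\<Sum>w\<in>rare_words Q D i i. J w)"
    using False by (intro sum_recent_rare_antimono J_Cons) auto
  moreover have "0 \<le> (\<Sum>w\<in>rare_words Q D i K. J w)"
    by (intro sum_nonneg J_nonneg) (auto simp: rare_words_def words_def)
  ultimately show ?thesis by (simp add: recent_words_short G_def)
qed

lemma stopped_entropy_le:
  assumes "m > 0"
  shows "(\<Sum>w\<in>leaves m (Suc K). eta (p w)) \<le> (\<Sum>q\<in>D. eta (p [q])) + H m"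
proof -
  have "(\<Sum>w\<in>leaves m (Suc K). eta (p w))
      = (\<Sum>q\<in>D. eta (p [q])) + (\<Sum>i<m. \<Sum>w\<in>recent_words Q D i K. J w)"
    unfolding leaves_def using assms
    by (simp add: chain_rule_stopped sum_active_eq_recent del: One_nat_def)
  also have "\<dots> \<le> (\<Sum>q\<in>D. eta (p [q])) + (\<Sum>i<m. G i)"
    by (intro add_left_mono sum_mono sum_recent_J_le_G)
  finally show ?thesis by (simp add: H_sum_G)
qed

lemma sum_p_active_le: "(\<Sum>w\<in>active_words Q D m n. p w) \<le> measure M (rare m n)"
  unfolding sum_p_rare_words[symmetric]
  by (intro sum_mono2) (auto simp: active_words_def rare_words_def)

end

text \<open>
Entropy of the induced process in terms of the original measure. Normalisation by the measure of \<open>E\<close> contributes a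
constant that does not depend on \<open>m\<close>.
\<close>
lemma (in sweeping) sum_eta_induced:
  assumes "finite_process N S P"
  shows "(\<Sum>u\<in>words P m. eta (measure M (finite_process.cyl N S u)))
    = measure M E * finite_process.H N S P m + eta (measure M E)"
proof -
  interpret NP: finite_process N S P by fact
  define c where "c = measure M E"
  have c: "c > 0" using measure_E_pos by (simp add: c_def)
  have p: "measure M (NP.cyl u) = c * NP.p u" if "u \<in> words P m" for u
    using measure_N[OF NP.cyl_sets[of u]] that c by (simp add: NP.p_def c_def words_def)
  have s: "(\<Sum>u\<in>words P m. NP.p u) = 1"
  proof -
    have "{x \<in> space N. NP.name m x \<in> words P m} = space N" using NP.name_in_words by blast
    then show ?thesis using NP.sum_p[of "words P m" m] NP.prob_space by simp
  qed
  have "(\<Sum>u\<in>words P m. eta (measure M (NP.cyl u)))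
      = (\<Sum>u\<in>words P m. c * eta (NP.p u) - NP.p u * (c * ln c))"
  proof (intro sum.cong refl)
    fix u assume "u \<in> words P m"
    then show "eta (measure M (NP.cyl u)) = c * eta (NP.p u) - NP.p u * (c * ln c)"
      using eta_divide[OF c, of "c * NP.p u"] c by (simp add: p)
  qed
  also have "\<dots> = c * NP.H m + eta c"
    by (simp add: sum_subtractf NP.H_def sum_distrib_left flip: sum_distrib_right) (simp add: s eta_def)
  finally show ?thesis by (simp add: c_def)
qed

context coded_process
begin

text \<open>
The name stopped at the \<open>m\<close>-th return determines the first \<open>m\<close> letters of the itinerary under \<open>S\<close>, and its entropy is at
most \<open>H m\<close> plus a constant. Names that are still active at time \<open>K\<close> are exceptional, and their measure
vanishes as \<open>K\<close> grows while \<open>m\<close> is fixed.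
\<close>
lemma induced_entropy_le:
  assumes P: "finite_measurable_partition N P" and "P \<subseteq> Q"
  shows "measure M E * entropy_wrt N S P \<le> entropy_wrt M T Q"
proof -
  interpret NP: finite_process N S P by (rule partition_N_process[OF P])
  define c where "c = measure M E"
  define C where "C = (\<Sum>q\<in>D. eta (p [q])) - eta c"
  have cells: "NP.cell x = cell x" if "x \<in> E" for x
    using NP.cell_in[of x] cell_eq[of x "NP.cell x"] that E_space \<open>P \<subseteq> Q\<close> by auto
  have Ssp: "(S ^^ i) x \<in> E" if "x \<in> E" for i x using NP.funpow_space[of x i] that by simp
  have bound: "c * NP.H m \<le> C + H m" if m: "m > 0" for m
  proof -
    have ineq: "c * NP.H m + eta c \<le> (\<Sum>q\<in>D. eta (p [q])) + H m
        + measure M (rare m (Suc K)) * ln (card (words P m))" for K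
    proof -
      have "c * NP.H m + eta c = (\<Sum>u\<in>words P m. eta (measure M (NP.cyl u)))"
        unfolding c_def by (rule sum_eta_induced[symmetric]) unfold_locales
      also have "\<dots> \<le> (\<Sum>w\<in>leaves m (Suc K). eta (measure M (cyl w)))
          + (\<Sum>w\<in>active_words Q D m (Suc K). measure M (cyl w)) * ln (card (words P m))"
      proof (rule entropy_le_refinement)
        show "disjoint_family_on NP.cyl (words P m)"
          by (rule NP.disjoint_cyl)
        show "NP.cyl u \<in> sets M" if "u \<in> words P m" for u
          using NP.cyl_sets[of u] that by (auto simp: words_def sets_N_iff)
        show "disjoint_family_on cyl (leaves m (Suc K))"
          using leaf_ex1[OF m, of _ K] leaf_cyl_subset[of _ m "Suc K"]
          unfolding disjoint_family_on_def by blast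
        show "cyl w \<in> sets M" if "w \<in> leaves m (Suc K)" for w
          using that by (intro cyl_sets leaves_subset)
        have "(\<Union>u\<in>words P m. NP.cyl u) = E" by (simp add: NP.Union_cyl)
        moreover have "(\<Union>w\<in>leaves m (Suc K). cyl w) = E"
          using leaf_ex1[OF m, of _ K] leaf_cyl_subset[of _ m "Suc K"] by blast
        ultimately show "(\<Union>u\<in>words P m. NP.cyl u) = (\<Union>w\<in>leaves m (Suc K). cyl w)" by simp
        show "active_words Q D m (Suc K) \<subseteq> leaves m (Suc K)" by (auto simp: leaves_def)
        fix w assume "w \<in> leaves m (Suc K) - active_words Q D m (Suc K)"
        then have w: "w \<in> stopped_words Q D m (Suc K)" "w \<in> leaves m (Suc K)"
          by (auto simp: leaves_def)
        show "cyl w = {} \<or> (\<exists>u\<in>words P m. cyl w \<subseteq> NP.cyl u)"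
        proof (rule disjCI)
          assume "\<not> (\<exists>u\<in>words P m. cyl w \<subseteq> NP.cyl u)"
          show "cyl w = {}"
          proof (rule ccontr)
            assume "cyl w \<noteq> {}"
            then obtain x where x: "x \<in> cyl w" by blast
            have xE: "x \<in> E" using x leaf_cyl_subset[OF w(2)] by blast
            have u: "NP.name m x \<in> words P m" using xE by (intro NP.name_in_words) simp
            have "y \<in> NP.cyl (NP.name m x)" if y: "y \<in> cyl w" for y
            proof -
              have yE: "y \<in> E" using y leaf_cyl_subset[OF w(2)] by blast
              have nx: "name (length w) x = w" and ny: "name (length w) y = w"
                using x y leaves_subset[OF w(2)] by (auto simp: mem_cyl)
              have cnt: "count (length w) x = Suc m"
                using visits_name[OF E_space[OF xE], of "length w"] nx w(1)
                by (simp add: stopped_words_def)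
              have "NP.cell ((S ^^ i) y) = NP.cell ((S ^^ i) x)" if "i < m" for i
              proof -
                have "name (length w) x = name (length w) y" "i < count (length w) x"
                  using nx ny cnt that by simp_all
                then obtain k
                  where k: "k < length w" "(S ^^ i) x = (T ^^ k) x" "(S ^^ i) y = (T ^^ k) y"
                  by (rule visits_agree[OF xE yE])
                have "cell ((T ^^ k) x) = cell ((T ^^ k) y)"
                  using k(1) nx ny nth_name by metis
                then show ?thesis using cells[OF Ssp[OF xE, of i]] cells[OF Ssp[OF yE, of i]] k by simp
              qed
              then have "NP.name m y = NP.name m x" by (simp add: list_eq_iff_nth_eq)
              then show ?thesis using u yE by (auto simp: NP.mem_cyl words_def)
            qed
            then show False using \<open>\<not> (\<exists>u\<in>words P m. cyl w \<subseteq> NP.cyl u)\<close> u by blast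
          qed
        qed
      qed auto
      also have "\<dots> \<le> ((\<Sum>q\<in>D. eta (p [q])) + H m)
          + measure M (rare m (Suc K)) * ln (card (words P m))"
      proof (intro add_mono mult_right_mono)
        show "(\<Sum>w\<in>leaves m (Suc K). eta (measure M (cyl w))) \<le> (\<Sum>q\<in>D. eta (p [q])) + H m"
          using stopped_entropy_le[OF m, of K] by (simp add: p_def)
        show "(\<Sum>w\<in>active_words Q D m (Suc K). measure M (cyl w)) \<le> measure M (rare m (Suc K))"
          using sum_p_active_le by (simp add: p_def)
        obtain a where "a \<in> E" using measure_E_pos by fastforce
        then have "NP.name m a \<in> words P m" by (intro NP.name_in_words) simp
        then have "card (words P m) > 0" by (auto simp: card_gt_0_iff)
        then show "0 \<le> ln (real (card (words P m)))" by simp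
      qed
      finally show ?thesis .
    qed
    have "(\<lambda>K. (\<Sum>q\<in>D. eta (p [q])) + H m + measure M (rare m (Suc K)) * ln (card (words P m)))
        \<longlonglongrightarrow> (\<Sum>q\<in>D. eta (p [q])) + H m + 0 * ln (card (words P m))"
      by (intro tendsto_intros LIMSEQ_Suc rare_measure_tendsto_0)
    then have "c * NP.H m + eta c \<le> (\<Sum>q\<in>D. eta (p [q])) + H m + 0 * ln (card (words P m))"
      by (rule LIMSEQ_le_const) (use ineq in auto)
    then show ?thesis by (simp add: C_def)
  qed
  have "c * entropy_wrt N S P \<le> 0 + entropy_wrt M T Q"
  proof (rule LIMSEQ_le)
    show "(\<lambda>m. c * (NP.H m / m)) \<longlonglongrightarrow> c * entropy_wrt N S P"
      by (intro tendsto_intros NP.entropy_tendsto)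
    show "(\<lambda>m. C / m + H m / m) \<longlonglongrightarrow> 0 + entropy_wrt M T Q"
      by (intro tendsto_add lim_const_over_n entropy_tendsto)
    have "c * (NP.H m / m) \<le> C / m + H m / m" if "m \<ge> 1" for m
    proof -
      have "c * NP.H m / m \<le> (C + H m) / m" using bound[of m] that by (intro divide_right_mono) auto
      then show ?thesis by (simp add: add_divide_distrib)
    qed
    then show "\<exists>N. \<forall>m\<ge>N. c * (NP.H m / m) \<le> C / m + H m / m" by blast
  qed
  then show ?thesis by (simp add: c_def)
qed

end

section \<open>The upper bound for the entropy of the system\<close>

lemma (in sweeping) induced_cyl_vimage_sets:
  assumes "finite_process N S P" and u: "set u \<subseteq> P" and A: "A \<in> sets M"
  shows "{x \<in> finite_process.cyl N S u. (S ^^ m) x \<in> A} \<in> sets M"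
proof -
  interpret NP: finite_process N S P by fact
  have "A \<inter> E \<in> sets N" using A by (auto simp: sets_N_iff)
  from measurable_sets[OF NP.funpow_measurable this, of m] NP.cyl_sets[OF u]
  have "NP.cyl u \<inter> ((S ^^ m) -` (A \<inter> E) \<inter> E) \<in> sets M" by (auto simp: sets_N_iff)
  also have "NP.cyl u \<inter> ((S ^^ m) -` (A \<inter> E) \<inter> E) = {x \<in> NP.cyl u. (S ^^ m) x \<in> A}"
    using NP.funpow_space by (auto simp: NP.cyl_def)
  finally show ?thesis .
qed

context coded_process
begin

text \<open>
Two points of \<open>E\<close> lie in the same cell if their names agree up to and including the first return, or during the first
\<open>l + 1\<close> times if there is no earlier return.
\<close>
definition excursion_partition :: "nat \<Rightarrow> 'a set set" where
  "excursion_partition l = cyl ` leaves 1 (Suc l) - {{}}"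

lemma excursion_partition: "finite_measurable_partition N (excursion_partition l)"
  unfolding finite_measurable_partition_def
proof (intro conjI)
  show "finite (excursion_partition l)" by (simp add: excursion_partition_def)
  show "excursion_partition l \<subseteq> sets N"
    using leaf_cyl_subset cyl_sets leaves_subset
    by (auto simp: excursion_partition_def sets_N_iff)
  show "partition_on (space N) (excursion_partition l)"
  proof (rule partition_onI)
    show "\<Union> (excursion_partition l) = space N"
    proof
      show "\<Union> (excursion_partition l) \<subseteq> space N"
        using leaf_cyl_subset by (fastforce simp: excursion_partition_def)
      show "space N \<subseteq> \<Union> (excursion_partition l)"
      proof
        fix x assume "x \<in> space N"
        then obtain b where "b \<in> leaves 1 (Suc l)" "x \<in> cyl b"
          using leaf_ex1[of 1 x l] by auto
        then show "x \<in> \<Union> (excursion_partition l)" by (auto simp: excursion_partition_def)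
      qed
    qed
    show "disjnt A B" if AB: "A \<in> excursion_partition l" "B \<in> excursion_partition l" "A \<noteq> B" for A B
    proof -
      obtain a b where ab: "a \<in> leaves 1 (Suc l)" "b \<in> leaves 1 (Suc l)" "A = cyl a" "B = cyl b"
        using AB by (auto simp: excursion_partition_def)
      have "x \<notin> B" if x: "x \<in> A" for x
      proof
        assume "x \<in> B"
        moreover have "x \<in> E" using x ab leaf_cyl_subset by blast
        ultimately have "a = b" using leaf_ex1[of 1 x l] ab x by auto
        then show False using ab \<open>A \<noteq> B\<close> by simp
      qed
      then show ?thesis by (auto simp: disjnt_def)
    qed
    show "{} \<notin> excursion_partition l" by (simp add: excursion_partition_def)
  qed
qed

lemma excursion_process: "finite_process N S (excursion_partition l)"
  by (rule partition_N_process[OF excursion_partition])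

lemma excursion_cell_eq:
  assumes b: "b \<in> leaves 1 (Suc l)" and x: "x \<in> cyl b" and y: "y \<in> cyl b"
  shows "finite_process.cell (excursion_partition l) x = finite_process.cell (excursion_partition l) y"
proof -
  interpret B: finite_process N S "excursion_partition l" by (rule excursion_process)
  have "cyl b \<in> excursion_partition l" using b x by (auto simp: excursion_partition_def)
  moreover have "x \<in> E" "y \<in> E" using leaf_cyl_subset[OF b] x y by auto
  ultimately show ?thesis using B.cell_eq[of x "cyl b"] B.cell_eq[of y "cyl b"] x y by simp
qed

text \<open>
A leaf name with one return never extends beyond that return: \<open>L\<close> letters with two visits already contain the starting
point and the return.
\<close>
lemma leaf_length_le_return:
  assumes b: "b \<in> leaves 1 (Suc l)" and z: "z \<in> cyl b" and L: "count L z = 2"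
  shows "length b \<le> L"
proof (rule ccontr)
  assume "\<not> length b \<le> L"
  then have len: "L < length b" by simp
  have zs: "z \<in> space M" and nb: "name (length b) z = b"
    using z leaves_subset[OF b] by (auto simp: mem_cyl)
  have v: "visits D b = count (length b) z" using visits_name[OF zs, of "length b"] nb by simp
  then have "visits D b \<ge> 2" using count_mono[of L "length b" z] L len by simp
  then have st: "b \<in> stopped_words Q D 1 (Suc l)"
    using b by (auto simp: leaves_def active_words_def)
  obtain k where k: "length b = Suc k" using len by (cases "length b") auto
  have "last b = cell ((T ^^ k) z)"
    using nb k by (metis last_snoc name_Suc_snoc)
  then have "(T ^^ k) z \<in> E"
    using st cell_in_D_iff[OF funpow_space[OF zs]] by (auto simp: stopped_words_def)
  then have "visits D b = Suc (count k z)" using v k by (simp add: count_Suc)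
  moreover have "count k z \<ge> 2" using count_mono[of L k z] L len k by simp
  ultimately show False using st by (simp add: stopped_words_def)
qed

text \<open>
A past back to the \<open>(m + 1)\<close>-st most recent visit contains \<open>m\<close> complete excursions, so it determines their cells.
\<close>
lemma excursion_name_eq:
  assumes w: "w \<in> recent_words Q D m K" and x: "x \<in> cyl w" and y: "y \<in> cyl w"
  shows "finite_process.name S (excursion_partition l) m x
       = finite_process.name S (excursion_partition l) m y"
proof -
  interpret B: finite_process N S "excursion_partition l" by (rule excursion_process)
  define n where "n = length w"
  have wQ: "set w \<subseteq> Q" and n: "n > 0" and hd: "hd w \<in> D" and v: "visits D w = Suc m"
    using w by (auto simp: recent_words_def n_def)
  have xs: "x \<in> space M" "y \<in> space M" and nx: "name n x = w" and ny: "name n y = w"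
    using x y wQ by (auto simp: mem_cyl n_def)
  have xE: "x \<in> E" and yE: "y \<in> E"
    using hd_name_in_D_iff[OF xs(1) n] hd_name_in_D_iff[OF xs(2) n] nx ny hd by auto
  have cnt: "count n x = Suc m" using visits_name[OF xs(1), of n] nx v by simp
  have eqn: "name n x = name n y" using nx ny by simp
  have "B.cell ((S ^^ i) x) = B.cell ((S ^^ i) y)" if i: "i < m" for i
  proof -
    obtain k where k: "k < n" "count k x = i" "(T ^^ k) x \<in> E"
      "(S ^^ i) x = (T ^^ k) x" "(S ^^ i) y = (T ^^ k) y"
      by (rule visits_agree[OF xE yE eqn, of i]) (use cnt i in auto)
    obtain k' where k': "k' < n" "count k' x = Suc i" "(T ^^ k') x \<in> E"
      by (rule visits_agree[OF xE yE eqn, of "Suc i"]) (use cnt i in auto)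
    have "k < k'" using count_mono[of k' k x] k(2) k'(2) by (cases "k < k'") auto
    (* the number of letters from visit i up to and including visit i + 1 *)
    define L where "L = Suc k' - k"
    define x' where "x' = (T ^^ k) x"
    define y' where "y' = (T ^^ k) y"
    have "count (k + L) x = count k x + count L x'" by (simp add: count_add x'_def)
    moreover have "k + L = Suc k'" using \<open>k < k'\<close> by (simp add: L_def)
    ultimately have L2: "count L x' = 2" using k(2) k' by (simp add: count_Suc)
    have "x' \<in> E" using k(3) by (simp add: x'_def)
    then obtain b where b: "b \<in> leaves 1 (Suc l)" "x' \<in> cyl b" using leaf_ex1[of 1 x' l] by auto
    have len: "length b \<le> L" by (rule leaf_length_le_return[OF b L2])
    have "name (length b) x' = name (length b) y'"
    proof (rule nth_equalityI)
      fix j assume j: "j < length (name (length b) x')"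
      then have "j + k < n" using len k'(1) \<open>k < k'\<close> by (simp add: L_def)
      then have "cell ((T ^^ (j + k)) x) = cell ((T ^^ (j + k)) y)" using eqn nth_name by metis
      then show "name (length b) x' ! j = name (length b) y' ! j"
        using j by (simp add: x'_def y'_def funpow_add)
    qed simp
    then have "y' \<in> cyl b"
      using b leaves_subset[OF b(1)] funpow_space[OF xs(2), of k] by (auto simp: mem_cyl y'_def)
    then have "B.cell x' = B.cell y'" by (rule excursion_cell_eq[OF b])
    then show ?thesis using k by (simp add: x'_def y'_def)
  qed
  then show ?thesis by (simp add: list_eq_iff_nth_eq)
qed

text \<open>
The chain rule for a single excursion, given the cells of the \<open>m\<close> excursions before it. Summed over the possible
beginnings \<open>b\<close> of the excursion it gives the entropy of \<open>m + 1\<close> excursions, minus the entropy of \<open>m\<close> excursions together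
with the starting letter of the next one. The latter is at least the entropy of \<open>m\<close> excursions.
\<close>
lemma sum_next_entropy_excursions:
  fixes C :: "'a set list \<Rightarrow> 'a set"
  defines "C \<equiv> finite_process.cyl N S"
  defines "f \<equiv> (\<lambda>m u v. measure M {x \<in> C u. (S ^^ m) x \<in> cyl v})"
  shows "(\<Sum>u\<in>words (excursion_partition l) m. \<Sum>b\<in>recent_words Q D 0 l. next_entropy Q (f m u) b)
    \<le> measure M E * (finite_process.H N S (excursion_partition l) (Suc m)
        - finite_process.H N S (excursion_partition l) m)"
proof -
  interpret B: finite_process N S "excursion_partition l" by (rule excursion_process)
  let ?B = "excursion_partition l"
  have Csub: "C u \<subseteq> E" for u by (auto simp: C_def B.cyl_def)
  have Ssp: "(S ^^ i) x \<in> E" if "x \<in> E" for i x using B.funpow_space[of x i] that by simp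
  have fsets: "{x \<in> C u. (S ^^ m) x \<in> A} \<in> sets M" if "u \<in> words ?B m" "A \<in> sets M" for u A
    using that unfolding C_def
    by (intro induced_cyl_vimage_sets[OF excursion_process]) (auto simp: words_def)
  have one: "(\<Sum>b\<in>recent_words Q D 0 l. next_entropy Q (f m u) b)
      = (\<Sum>b\<in>leaves 1 (Suc l). eta (f m u b)) - (\<Sum>q\<in>D. eta (f m u [q]))" for u
  proof -
    have "(\<Sum>b\<in>leaves 1 (Suc l). eta (f m u b)) = (\<Sum>q\<in>D. eta (f m u [q]))
        + (\<Sum>n=1..l. \<Sum>w\<in>active_words Q D 1 n. next_entropy Q (f m u) w)"
      unfolding leaves_def by (simp only: chain_rule_stopped finite_Q zero_less_one Q_Int_D)
    also have "(\<Sum>n=1..l. \<Sum>w\<in>active_words Q D 1 n. next_entropy Q (f m u) w)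
        = (\<Sum>b\<in>recent_words Q D 0 l. next_entropy Q (f m u) b)"
      by (subst sum_active_eq_recent) auto
    finally show ?thesis by simp
  qed
  have leafsum: "(\<Sum>b\<in>leaves 1 (Suc l). eta (f m u b))
      = (\<Sum>\<beta>\<in>?B. eta (measure M {x \<in> C u. (S ^^ m) x \<in> \<beta>}))" for u
  proof -
    let ?g = "\<lambda>\<beta>. eta (measure M {x \<in> C u. (S ^^ m) x \<in> \<beta>})"
    have "(\<Sum>\<beta>\<in>?B. ?g \<beta>) = (\<Sum>\<beta>\<in>cyl ` leaves 1 (Suc l). ?g \<beta>)"
      unfolding excursion_partition_def by (rule sum.mono_neutral_left) auto
    also have "\<dots> = (\<Sum>b\<in>leaves 1 (Suc l). ?g (cyl b))"
    proof (rule sum.reindex_nontrivial[unfolded comp_def])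
      fix a b assume ab: "a \<in> leaves 1 (Suc l)" "b \<in> leaves 1 (Suc l)" "a \<noteq> b" "cyl a = cyl b"
      have "cyl a = {}"
      proof (rule ccontr)
        assume "cyl a \<noteq> {}"
        then obtain x where "x \<in> cyl a" by blast
        moreover from this have "x \<in> E" using leaf_cyl_subset[OF ab(1)] by blast
        ultimately show False using leaf_ex1[of 1 x l] ab by auto
      qed
      then show "?g (cyl a) = 0" by simp
    qed simp
    finally show ?thesis by (simp add: f_def)
  qed
  have join: "(\<Sum>u\<in>words ?B m. \<Sum>\<beta>\<in>?B. eta (measure M {x \<in> C u. (S ^^ m) x \<in> \<beta>}))
      = measure M E * B.H (Suc m) + eta (measure M E)"
  proof -
    have "C (u @ [\<beta>]) = {x \<in> C u. (S ^^ m) x \<in> \<beta>}" if "u \<in> words ?B m" for u \<beta>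
      using that by (auto simp: C_def B.cyl_def words_def nth_append less_Suc_eq)
    then have "(\<Sum>u\<in>words ?B m. \<Sum>\<beta>\<in>?B. eta (measure M {x \<in> C u. (S ^^ m) x \<in> \<beta>}))
        = (\<Sum>v\<in>words ?B (Suc m). eta (measure M (C v)))"
      by (simp add: sum_words_snoc)
    also have "\<dots> = measure M E * B.H (Suc m) + eta (measure M E)"
      unfolding C_def by (rule sum_eta_induced[OF excursion_process])
    finally show ?thesis .
  qed
  have initial: "eta (measure M (C u)) \<le> (\<Sum>q\<in>D. eta (f m u [q]))" if u: "u \<in> words ?B m" for u
  proof -
    have c1: "cyl [q] = q" if "q \<in> D" for q
      using that Q_sets[of q] sets.sets_into_space[of q M] by (auto simp: cyl_def D_def)
    have "C u = (\<Union>q\<in>D. {x \<in> C u. (S ^^ m) x \<in> cyl [q]})"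
    proof (intro equalityI subsetI)
      fix x assume x: "x \<in> C u"
      then have "(S ^^ m) x \<in> E" using Csub Ssp by blast
      then have "cell ((S ^^ m) x) \<in> D" "(S ^^ m) x \<in> cell ((S ^^ m) x)"
        using cell_in_D_iff cell_in E_space by blast+
      then show "x \<in> (\<Union>q\<in>D. {x \<in> C u. (S ^^ m) x \<in> cyl [q]})" using x c1 by auto
    qed auto
    moreover have "measure M (\<Union>q\<in>D. {x \<in> C u. (S ^^ m) x \<in> cyl [q]}) = (\<Sum>q\<in>D. f m u [q])"
      unfolding f_def
    proof (rule finite_measure_finite_Union)
      show "finite D" by (simp add: D_def)
      show "(\<lambda>q. {x \<in> C u. (S ^^ m) x \<in> cyl [q]}) ` D \<subseteq> sets M"
        using fsets[OF u] cyl_sets by (auto simp: D_def)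
      show "disjoint_family_on (\<lambda>q. {x \<in> C u. (S ^^ m) x \<in> cyl [q]}) D"
        using disjointD[OF partition_onD2[OF partition_Q]] c1
        by (fastforce simp: disjoint_family_on_def D_def)
    qed
    ultimately have "measure M (C u) = (\<Sum>q\<in>D. f m u [q])" by simp
    then show ?thesis
      using eta_sum_le[of D "\<lambda>q. f m u [q]"] by (simp add: D_def f_def)
  qed
  have "(\<Sum>u\<in>words ?B m. \<Sum>b\<in>recent_words Q D 0 l. next_entropy Q (f m u) b)
      \<le> (\<Sum>u\<in>words ?B m. (\<Sum>\<beta>\<in>?B. eta (measure M {x \<in> C u. (S ^^ m) x \<in> \<beta>})) - eta (measure M (C u)))"
    unfolding one leafsum by (intro sum_mono diff_left_mono initial)
  also have "\<dots> = (measure M E * B.H (Suc m) + eta (measure M E)) - (measure M E * B.H m + eta (measure M E))"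
    unfolding sum_subtractf join unfolding C_def sum_eta_induced[OF excursion_process] ..
  finally show ?thesis by (simp add: algebra_simps)
qed

text \<open>
A recent word with \<open>m + 1\<close> visits is \<open>v @ b\<close>, where \<open>b\<close> starts at the last visit and \<open>v\<close> consists of \<open>m\<close> complete
excursions. Forgetting everything about \<open>v\<close> except the cells \<open>u\<close> of its excursions merges several words \<open>v\<close> into one
condition, which can only increase the entropy of the next letter.
\<close>
lemma sum_J_same_suffix_le:
  fixes C :: "'a set list \<Rightarrow> 'a set" and l m K :: nat
  defines "C \<equiv> finite_process.cyl N S"
  assumes b: "b \<in> recent_words Q D 0 l"
  shows "(\<Sum>v\<in>{v. v @ b \<in> recent_words Q D m K}. J (v @ b))
    \<le> (\<Sum>u\<in>words (excursion_partition l) m.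
         next_entropy Q (\<lambda>w. measure M {x \<in> C u. (S ^^ m) x \<in> cyl w}) b)"
proof -
  interpret B: finite_process N S "excursion_partition l" by (rule excursion_process)
  let ?B = "excursion_partition l"
  let ?W = "{v. v @ b \<in> recent_words Q D m K}"
  have bQ: "set b \<subseteq> Q" "b \<noteq> []" "hd b \<in> D" "visits D b = 1"
    using b by (auto simp: recent_words_def)
  have finW: "finite ?W"
    using finite_imageD[of "\<lambda>v. v @ b" ?W] finite_subset[of "(\<lambda>v. v @ b) ` ?W" "recent_words Q D m K"]
    by (auto simp: inj_on_def)
  have vQ: "set v \<subseteq> Q" "visits D v = m" if "v \<in> ?W" for v
    using that bQ by (auto simp: recent_words_def)
  have Csets: "C u \<in> sets M" if "u \<in> words ?B m" for u
    using B.cyl_sets[of u] that by (auto simp: C_def sets_N_iff words_def)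
  have fsets: "{x \<in> C u. (S ^^ m) x \<in> A} \<in> sets M" if "u \<in> words ?B m" "A \<in> sets M" for u A
    using that unfolding C_def
    by (intro induced_cyl_vimage_sets[OF excursion_process]) (auto simp: words_def)
  have visit: "x \<in> E" "(T ^^ length v) x \<in> E" "count (length v) x = m"
      "(T ^^ length v) x \<in> cyl (b @ r)"
    if v: "v \<in> ?W" and r: "set r \<subseteq> Q" and x: "x \<in> cyl (v @ b @ r)" for v r x
  proof -
    have xs: "x \<in> space M" and nm: "name (length (v @ b @ r)) x = v @ b @ r"
      using x vQ[OF v] bQ r by (auto simp: mem_cyl)
    have split: "name (length v) x = v" "name (length (b @ r)) ((T ^^ length v) x) = b @ r"
      using nm name_add[of "length v" "length (b @ r)" x] by auto
    show "(T ^^ length v) x \<in> cyl (b @ r)"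
      using split bQ r funpow_space[OF xs] by (subst mem_cyl) auto
    show "count (length v) x = m" using visits_name[OF xs, of "length v"] split vQ[OF v] by simp
    have "hd (b @ r) \<in> D" using bQ by simp
    then show "(T ^^ length v) x \<in> E"
      using hd_name_in_D_iff[OF funpow_space[OF xs], of "length (b @ r)" "length v"] split bQ by simp
    have "hd (v @ b @ r) \<in> D"
      using v bQ by (cases v) (auto simp: recent_words_def)
    then show "x \<in> E"
      using hd_name_in_D_iff[OF xs, of "length (v @ b @ r)"] nm bQ by simp
  qed
  have split1: "J (v @ b) = (\<Sum>u\<in>words ?B m. split_entropy (\<lambda>q. measure M (cyl (v @ b @ [q]) \<inter> C u)) Q)"
    if v: "v \<in> ?W" for v
  proof (cases "cyl (v @ b) = {}")
    case True
    have "cyl (v @ b @ [q]) = {}" for q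
    proof -
      have "cyl ((v @ b) @ [q]) \<subseteq> cyl (v @ b)" by (auto simp: cyl_def nth_append)
      then show ?thesis using True by simp
    qed
    then show ?thesis using vQ[OF v] bQ by (simp add: J_split split_entropy_def p_def)
  next
    case False
    then obtain x where x: "x \<in> cyl (v @ b)" by blast
    have xE: "x \<in> E" using visit(1)[OF v, of "[]" x] x by simp
    define u0 where "u0 = B.name m x"
    have u0: "u0 \<in> words ?B m" using xE B.name_in_words by (simp add: u0_def)
    have inC: "y \<in> C u \<longleftrightarrow> u = u0" if y: "y \<in> cyl (v @ b)" and u: "u \<in> words ?B m" for y u
    proof -
      have "B.name m y = u0"
        unfolding u0_def using v y x by (intro excursion_name_eq[of "v @ b" m K]) auto
      moreover have "y \<in> E" using visit(1)[OF v, of "[]" y] y by simp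
      ultimately show ?thesis using u by (auto simp: C_def B.mem_cyl words_def)
    qed
    have "cyl (v @ b @ [q]) \<inter> C u = (if u = u0 then cyl (v @ b @ [q]) else {})"
      if "u \<in> words ?B m" for u q
    proof -
      have "cyl ((v @ b) @ [q]) \<subseteq> cyl (v @ b)" by (auto simp: cyl_def nth_append)
      then show ?thesis using inC that by auto
    qed
    then have "(\<Sum>u\<in>words ?B m. split_entropy (\<lambda>q. measure M (cyl (v @ b @ [q]) \<inter> C u)) Q)
        = (\<Sum>u\<in>words ?B m. if u = u0 then split_entropy (\<lambda>q. p (v @ b @ [q])) Q else 0)"
      by (intro sum.cong refl) (simp add: split_entropy_def p_def)
    then show ?thesis using u0 vQ[OF v] bQ by (simp add: J_split B.finite_Q)
  qed
  have "(\<Sum>v\<in>?W. J (v @ b))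
      = (\<Sum>u\<in>words ?B m. \<Sum>v\<in>?W. split_entropy (\<lambda>q. measure M (cyl (v @ b @ [q]) \<inter> C u)) Q)"
    by (subst sum.swap) (intro sum.cong refl split1)
  also have "\<dots> \<le> (\<Sum>u\<in>words ?B m.
         next_entropy Q (\<lambda>w. measure M {x \<in> C u. (S ^^ m) x \<in> cyl w}) b)"
  proof (rule sum_mono)
    fix u assume u: "u \<in> words ?B m"
    have disj: "cyl (v @ b @ r) \<inter> cyl (v' @ b @ r) = {}"
      if "v \<in> ?W" "v' \<in> ?W" "v \<noteq> v'" "set r \<subseteq> Q" for v v' r
    proof (rule ccontr)
      assume "cyl (v @ b @ r) \<inter> cyl (v' @ b @ r) \<noteq> {}"
      then obtain x where x: "x \<in> cyl (v @ b @ r)" "x \<in> cyl (v' @ b @ r)" by blast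
      have "\<not> k < k'" if "(T ^^ k) x \<in> E" "count k x = m" "count k' x = m" for k k'
        using that count_mono[of "Suc k" k' x] by (auto simp: count_Suc)
      then have "length v = length v'"
        using visit[OF that(1,4) x(1)] visit[OF that(2,4) x(2)] by (metis nat_neq_iff)
      then have "v @ b @ r = v' @ b @ r"
        using x that vQ bQ by (auto simp: mem_cyl)
      then show False using that by simp
    qed
    have "(\<Sum>v\<in>?W. split_entropy (\<lambda>q. measure M (cyl (v @ b @ [q]) \<inter> C u)) Q)
        \<le> split_entropy (\<lambda>q. \<Sum>v\<in>?W. measure M (cyl (v @ b @ [q]) \<inter> C u)) Q"
      using finW by (intro split_entropy_sum) auto
    also have "\<dots> \<le> split_entropy (\<lambda>q. measure M {x \<in> C u. (S ^^ m) x \<in> cyl (b @ [q])}) Q"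
    proof (rule split_entropy_mono)
      fix q assume q: "q \<in> Q"
      have "(\<Sum>v\<in>?W. measure M (cyl (v @ b @ [q]) \<inter> C u)) = measure M (\<Union>v\<in>?W. cyl (v @ b @ [q]) \<inter> C u)"
      proof (rule finite_measure_finite_Union[symmetric])
        show "(\<lambda>v. cyl (v @ b @ [q]) \<inter> C u) ` ?W \<subseteq> sets M"
        proof (rule image_subsetI)
          fix v assume "v \<in> ?W"
          then have "set (v @ b @ [q]) \<subseteq> Q" using vQ(1)[of v] bQ q by simp
          then show "cyl (v @ b @ [q]) \<inter> C u \<in> sets M" using Csets[OF u] by (intro sets.Int cyl_sets)
        qed
        show "disjoint_family_on (\<lambda>v. cyl (v @ b @ [q]) \<inter> C u) ?W"
          using disj[of _ _ "[q]"] q by (fastforce simp: disjoint_family_on_def)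
      qed (rule finW)
      also have "\<dots> \<le> measure M {x \<in> C u. (S ^^ m) x \<in> cyl (b @ [q])}"
      proof (rule finite_measure_mono)
        show "{x \<in> C u. (S ^^ m) x \<in> cyl (b @ [q])} \<in> sets M"
          using u q bQ by (intro fsets cyl_sets) auto
        show "(\<Union>v\<in>?W. cyl (v @ b @ [q]) \<inter> C u) \<subseteq> {x \<in> C u. (S ^^ m) x \<in> cyl (b @ [q])}"
        proof
          fix x assume "x \<in> (\<Union>v\<in>?W. cyl (v @ b @ [q]) \<inter> C u)"
          then obtain v where v: "v \<in> ?W" "x \<in> cyl (v @ b @ [q])" "x \<in> C u" by blast
          have vis: "x \<in> E" "(T ^^ length v) x \<in> E" "count (length v) x = m"
            "(T ^^ length v) x \<in> cyl (b @ [q])"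
            using visit[OF v(1) _ v(2)] q by auto
          then have "(S ^^ m) x = (T ^^ length v) x"
            using induced_map_funpow[OF vis(1,2)] by simp
          then show "x \<in> {x \<in> C u. (S ^^ m) x \<in> cyl (b @ [q])}" using v vis by simp
        qed
      qed
      finally show "(\<Sum>v\<in>?W. measure M (cyl (v @ b @ [q]) \<inter> C u))
          \<le> measure M {x \<in> C u. (S ^^ m) x \<in> cyl (b @ [q])}" .
    qed (auto intro: sum_nonneg)
    also have "\<dots> = next_entropy Q (\<lambda>w. measure M {x \<in> C u. (S ^^ m) x \<in> cyl w}) b"
    proof (rule next_entropy_split[symmetric])
      have bq: "x \<in> cyl (b @ [q]) \<longleftrightarrow> x \<in> cyl b \<and> cell ((T ^^ length b) x) = q" if "q \<in> Q" for x q
        using that bQ by (auto simp: mem_cyl name_Suc_snoc)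
      have "{x \<in> C u. (S ^^ m) x \<in> cyl b} = (\<Union>q\<in>Q. {x \<in> C u. (S ^^ m) x \<in> cyl (b @ [q])})"
      proof (intro equalityI subsetI)
        fix x assume x: "x \<in> {x \<in> C u. (S ^^ m) x \<in> cyl b}"
        then have "(S ^^ m) x \<in> space M" by (simp add: cyl_def)
        then have "cell ((T ^^ length b) ((S ^^ m) x)) \<in> Q" by (intro cell_in funpow_space)
        then show "x \<in> (\<Union>q\<in>Q. {x \<in> C u. (S ^^ m) x \<in> cyl (b @ [q])})" using x bq by blast
      qed (use bq in auto)
      also have "measure M \<dots> = (\<Sum>q\<in>Q. measure M {x \<in> C u. (S ^^ m) x \<in> cyl (b @ [q])})"
      proof (rule finite_measure_finite_Union)
        show "(\<lambda>q. {x \<in> C u. (S ^^ m) x \<in> cyl (b @ [q])}) ` Q \<subseteq> sets M"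
          using u bQ by (auto intro!: fsets cyl_sets)
        show "disjoint_family_on (\<lambda>q. {x \<in> C u. (S ^^ m) x \<in> cyl (b @ [q])}) Q"
          using bq by (fastforce simp: disjoint_family_on_def)
      qed simp
      finally show "measure M {x \<in> C u. (S ^^ m) x \<in> cyl b}
          = (\<Sum>q\<in>Q. measure M {x \<in> C u. (S ^^ m) x \<in> cyl (b @ [q])})" .
    qed
    finally show "(\<Sum>v\<in>?W. split_entropy (\<lambda>q. measure M (cyl (v @ b @ [q]) \<inter> C u)) Q)
        \<le> next_entropy Q (\<lambda>w. measure M {x \<in> C u. (S ^^ m) x \<in> cyl w}) b" .
  qed
  finally show ?thesis .
qed

text \<open>
Sort the words by the part \<open>b\<close> that starts at the last visit. It has at most \<open>l\<close> letters, so the chain rule for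
a single excursion cut off after \<open>l\<close> steps covers all \<open>b\<close> that occur.
\<close>
lemma sum_J_recent_excursion_le:
  shows "(\<Sum>w\<in>{w \<in> recent_words Q D m K. visits D (take l (rev w)) > 0}. J w)
    \<le> measure M E * (finite_process.H N S (excursion_partition l) (Suc m)
        - finite_process.H N S (excursion_partition l) m)"
    (is "(\<Sum>w\<in>?R. J w) \<le> ?rhs")
proof -
  let ?W = "\<lambda>b. {v. v @ b \<in> recent_words Q D m K}"
  let ?I = "SIGMA b:recent_words Q D 0 l. ?W b"
  have finW: "finite (?W b)" for b
    using finite_imageD[of "\<lambda>v. v @ b" "?W b"]
      finite_subset[of "(\<lambda>v. v @ b) ` ?W b" "recent_words Q D m K"]
    by (auto simp: inj_on_def)
  have finI: "finite ?I" using finW by (intro finite_SigmaI) auto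
  have sub: "?R \<subseteq> (\<lambda>(b, v). v @ b) ` ?I"
  proof
    fix w assume w: "w \<in> ?R"
    then have wr: "w \<in> recent_words Q D m K" and vis: "visits D (take l (rev w)) > 0" by auto
    have "\<exists>q\<in>set w. q \<in> D"
      using wr by (intro bexI[of _ "hd w"]) (auto simp: recent_words_def)
    then obtain v q r where w_eq: "w = v @ q # r" "q \<in> D" "\<forall>z\<in>set r. z \<notin> D"
      using split_list_last_prop[of w "\<lambda>q. q \<in> D"] by blast
    have r0: "filter (\<lambda>q. q \<in> D) r = []" using w_eq by (simp add: filter_empty_conv)
    have "length r < l"
    proof (rule ccontr)
      assume "\<not> length r < l"
      then have "take l (rev w) = take l (rev r)" by (simp add: w_eq)
      moreover have "visits D (take l (rev r)) = 0"
        using w_eq(3) by (auto simp: visits_def filter_empty_conv dest: in_set_takeD)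
      ultimately show False using vis by simp
    qed
    then have "q # r \<in> recent_words Q D 0 l"
      using wr w_eq r0 by (auto simp: recent_words_def visits_def)
    then show "w \<in> (\<lambda>(b, v). v @ b) ` ?I"
      using wr w_eq by (intro image_eqI[of _ _ "(q # r, v)"]) auto
  qed
  have nn: "0 \<le> J ((\<lambda>(b, v). v @ b) i)" if "i \<in> ?I" for i
    using that by (auto simp: recent_words_def intro!: J_nonneg)
  have "(\<Sum>w\<in>?R. J w) \<le> (\<Sum>w\<in>(\<lambda>(b, v). v @ b) ` ?I. J w)"
    using finI sub nn by (intro sum_mono2) auto
  also have "\<dots> \<le> (\<Sum>i\<in>?I. J ((\<lambda>(b, v). v @ b) i))"
    using sum_image_le[OF finI, of J "\<lambda>(b, v). v @ b"] nn by (simp add: comp_def)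
  also have "\<dots> = (\<Sum>b\<in>recent_words Q D 0 l. \<Sum>v\<in>?W b. J (v @ b))"
    using finW by (subst sum.Sigma) (auto simp: case_prod_unfold)
  also have "\<dots> \<le> (\<Sum>b\<in>recent_words Q D 0 l. \<Sum>u\<in>words (excursion_partition l) m.
      next_entropy Q (\<lambda>w. measure M {x \<in> finite_process.cyl N S u. (S ^^ m) x \<in> cyl w}) b)"
    by (intro sum_mono sum_J_same_suffix_le)
  also have "\<dots> \<le> ?rhs"
    by (subst sum.swap) (rule sum_next_entropy_excursions)
  finally show ?thesis .
qed

text \<open>
The cylinders of these words, placed so that they end at the same time, are disjoint and consist of points without
a visit during the last \<open>l\<close> steps. In terms of words: the masses of the words without a visit among their last \<open>l\<close>
letters do not increase under extension to the left, so the window can be shrunk to length \<open>l\<close>.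
\<close>
lemma sum_p_recent_late_le:
  assumes "l \<le> K"
  shows "(\<Sum>w\<in>{w \<in> recent_words Q D m K. visits D (take l (rev w)) = 0}. p w) \<le> measure M (rare 0 l)"
proof -
  (* For a word shorter than l all of its letters are tested. *)
  define F where "F w = (if visits D (take l (rev w)) = 0 then p w else 0)" for w
  have visits_rev: "visits D (rev w) = visits D w" for w
    by (simp add: visits_def rev_filter[symmetric])
  have F_le: "(\<Sum>q\<in>Q. F (q # w)) \<le> F w" if w: "set w \<subseteq> Q" for w
  proof (cases "visits D (take l (rev w)) = 0")
    case True
    have "(\<Sum>q\<in>Q. F (q # w)) \<le> (\<Sum>q\<in>Q. p (q # w))" by (intro sum_mono) (simp add: F_def)
    then show ?thesis using True w by (simp add: F_def p_Cons[of w])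
  next
    case False
    then show ?thesis by (simp add: F_def)
  qed
  have "(\<Sum>w\<in>{w \<in> recent_words Q D m K. visits D (take l (rev w)) = 0}. p w)
      = (\<Sum>w\<in>recent_words Q D m K. F w)"
    by (rule sum.mono_neutral_cong_left) (auto simp: F_def)
  also have "\<dots> \<le> (\<Sum>w\<in>recent_words Q D m K. F w) + (\<Sum>w\<in>rare_words Q D m K. F w)"
    by (auto intro!: sum_nonneg simp: F_def)
  also have "\<dots> \<le> (\<Sum>w\<in>recent_words Q D m l. F w) + (\<Sum>w\<in>rare_words Q D m l. F w)"
    using assms F_le by (intro sum_recent_rare_antimono) auto
  also have "(\<Sum>w\<in>recent_words Q D m l. F w) = 0"
    by (rule sum.neutral) (auto simp: F_def recent_words_def visits_rev)
  also have "(\<Sum>w\<in>rare_words Q D m l. F w) = (\<Sum>w\<in>rare_words Q D 0 l. p w)"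
  proof (rule sum.mono_neutral_cong_right)
    show "finite (rare_words Q D m l)" by simp
  qed (auto simp: F_def rare_words_def words_def visits_rev)
  finally show ?thesis by (simp add: sum_p_rare_words)
qed

text \<open>
The words of length \<open>K\<close> are split into three kinds: at most \<open>m\<close> visits, no visit among the last \<open>l\<close> letters of the recent
suffix, and the rest. The first two kinds are bounded by \<open>ln (card Q)\<close> times their measure.
\<close>
lemma G_le:
  assumes "l \<le> K"
  shows "G K \<le> ln (card Q) * (measure M (rare m K) + measure M (rare 0 l))
    + measure M E * (finite_process.H N S (excursion_partition l) (Suc m)
        - finite_process.H N S (excursion_partition l) m)"
proof -
  let ?R = "recent_words Q D m K"
  have J_le: "(\<Sum>w\<in>A. J w) \<le> ln (card Q) * (\<Sum>w\<in>A. p w)" if "\<And>w. w \<in> A \<Longrightarrow> set w \<subseteq> Q" for A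
    unfolding sum_distrib_left using that J_le_card by (intro sum_mono) (simp add: mult.commute)
  have card: "0 \<le> ln (real (card Q))"
    using Q_nonempty by (simp add: card_gt_0_iff Suc_le_eq)
  have "G K = (\<Sum>w\<in>rare_words Q D m K. J w) + (\<Sum>w\<in>{w \<in> words Q K. m < visits D w}. J w)"
    using sum_filter_split[of "words Q K" J "\<lambda>w. visits D w \<le> m"]
    by (simp add: G_def rare_words_def not_le)
  also have "(\<Sum>w\<in>{w \<in> words Q K. m < visits D w}. J w) \<le> (\<Sum>w\<in>?R. J w)"
    by (intro sum_frequent_le_recent J_Cons) auto
  also have "(\<Sum>w\<in>?R. J w) = (\<Sum>w\<in>{w \<in> ?R. visits D (take l (rev w)) = 0}. J w)
      + (\<Sum>w\<in>{w \<in> ?R. visits D (take l (rev w)) > 0}. J w)"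
    using sum_filter_split[of ?R J "\<lambda>w. visits D (take l (rev w)) = 0"] by simp
  finally have "G K \<le> (\<Sum>w\<in>rare_words Q D m K. J w)
      + ((\<Sum>w\<in>{w \<in> ?R. visits D (take l (rev w)) = 0}. J w)
      + (\<Sum>w\<in>{w \<in> ?R. visits D (take l (rev w)) > 0}. J w))" by simp
  moreover have "(\<Sum>w\<in>rare_words Q D m K. J w) \<le> ln (card Q) * measure M (rare m K)"
    unfolding sum_p_rare_words[symmetric]
    by (rule J_le) (auto simp: rare_words_def words_def)
  moreover have "(\<Sum>w\<in>{w \<in> ?R. visits D (take l (rev w)) = 0}. J w) \<le> ln (card Q) * measure M (rare 0 l)"
    using mult_left_mono[OF sum_p_recent_late_le[OF \<open>l \<le> K\<close>] card]
    by (intro order_trans[OF J_le]) (auto simp: recent_words_def)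
  ultimately show ?thesis
    using sum_J_recent_excursion_le[of m K l] by (simp add: algebra_simps)
qed

text \<open>
The window \<open>K\<close> tends to infinity for fixed \<open>m\<close>; then the bound is averaged over \<open>m\<close>, so that the increments of the
entropy of the induced process add up to its entropy rate.
\<close>
lemma entropy_le_induced:
  shows "entropy_wrt M T Q \<le> ln (card Q) * measure M (rare 0 l)
    + measure M E * entropy_wrt N S (excursion_partition l)"
proof -
  interpret B: finite_process N S "excursion_partition l" by (rule excursion_process)
  define h where "h = entropy_wrt M T Q"
  define c where "c = measure M E"
  define \<epsilon> where "\<epsilon> = ln (card Q) * measure M (rare 0 l)"
  have step: "h \<le> \<epsilon> + c * (B.H (Suc m) - B.H m)" for m
  proof -
    have "(\<lambda>K. ln (card Q) * (measure M (rare m K) + measure M (rare 0 l)) + c * (B.H (Suc m) - B.H m))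
        \<longlonglongrightarrow> ln (card Q) * (0 + measure M (rare 0 l)) + c * (B.H (Suc m) - B.H m)"
      by (intro tendsto_intros rare_measure_tendsto_0)
    moreover have "h \<le> ln (card Q) * (measure M (rare m K) + measure M (rare 0 l)) + c * (B.H (Suc m) - B.H m)"
      if "K \<ge> l" for K
      using entropy_wrt_le_G[of K] G_le[OF that, of m] by (simp add: h_def c_def)
    ultimately have "h \<le> ln (card Q) * (0 + measure M (rare 0 l)) + c * (B.H (Suc m) - B.H m)"
      by (intro LIMSEQ_le_const) auto
    then show ?thesis by (simp add: \<epsilon>_def)
  qed
  have total: "real n * h \<le> real n * \<epsilon> + c * B.H n" for n
  proof (induction n)
    case (Suc n)
    then show ?case using step[of n] by (simp add: algebra_simps)
  qed simp
  have "h \<le> \<epsilon> + c * entropy_wrt N S (excursion_partition l)"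
  proof (rule LIMSEQ_le_const)
    show "(\<lambda>n. \<epsilon> + c * (B.H n / n)) \<longlonglongrightarrow> \<epsilon> + c * entropy_wrt N S (excursion_partition l)"
      by (intro tendsto_intros B.entropy_tendsto)
    have "h \<le> \<epsilon> + c * (B.H n / n)" if "n \<ge> 1" for n
      using total[of n] that by (simp add: field_simps)
    then show "\<exists>N. \<forall>n\<ge>N. h \<le> \<epsilon> + c * (B.H n / n)" by blast
  qed
  then show ?thesis by (simp add: h_def c_def \<epsilon>_def)
qed

end

section \<open>The Abramov formula\<close>

lemma (in mp_system) entropy_wrt_mono_refinement:
  assumes P: "finite_measurable_partition M P" and Q: "finite_measurable_partition M Q"
    and refines: "\<And>q. q \<in> Q \<Longrightarrow> \<exists>a\<in>P. q \<subseteq> a"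
  shows "entropy_wrt M T P \<le> entropy_wrt M T Q"
proof -
  interpret P: finite_process M T P by unfold_locales (rule P)
  interpret Q: finite_process M T Q by unfold_locales (rule Q)
  obtain \<phi> where \<phi>: "\<phi> q \<in> P" "q \<subseteq> \<phi> q" if "q \<in> Q" for q using refines by metis
  have "P.H n \<le> Q.H n" for n
  proof -
    have "(\<Sum>w\<in>words P n. eta (measure M (P.cyl w))) \<le> (\<Sum>w\<in>words Q n. eta (measure M (Q.cyl w)))
        + (\<Sum>w\<in>({} :: 'a set list set). measure M (Q.cyl w)) * ln (card (words P n))"
    proof (rule entropy_le_refinement)
      show "disjoint_family_on P.cyl (words P n)"
        by (rule P.disjoint_cyl)
      show "disjoint_family_on Q.cyl (words Q n)"
        by (rule Q.disjoint_cyl)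
      show "(\<Union>w\<in>words P n. P.cyl w) = (\<Union>w\<in>words Q n. Q.cyl w)"
        by (simp only: P.Union_cyl Q.Union_cyl)
      show "P.cyl u \<in> sets M" if "u \<in> words P n" for u
        using that by (intro P.cyl_sets) (simp add: words_def)
      show "Q.cyl u \<in> sets M" if "u \<in> words Q n" for u
        using that by (intro Q.cyl_sets) (simp add: words_def)
      fix w assume w: "w \<in> words Q n - {}"
      have "map \<phi> w \<in> words P n" using w \<phi> by (auto simp: words_def)
      moreover have "Q.cyl w \<subseteq> P.cyl (map \<phi> w)"
      proof
        fix x assume x: "x \<in> Q.cyl w"
        have "(T ^^ j) x \<in> \<phi> (w ! j)" if "j < length w" for j
        proof -
          have "w ! j \<in> Q" using w that nth_mem[OF that] by (auto simp: words_def)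
          moreover have "(T ^^ j) x \<in> w ! j" using x that by (simp add: Q.cyl_def)
          ultimately show ?thesis using \<phi>(2) by blast
        qed
        then show "x \<in> P.cyl (map \<phi> w)" using x by (simp add: P.cyl_def Q.cyl_def)
      qed
      ultimately show "Q.cyl w = {} \<or> (\<exists>u\<in>words P n. Q.cyl w \<subseteq> P.cyl u)" by blast
    qed simp_all
    then show ?thesis by (simp add: P.H_def Q.H_def P.p_def Q.p_def)
  qed
  then have "P.H n / n \<le> Q.H n / n" for n by (intro divide_right_mono) auto
  then show ?thesis by (intro LIMSEQ_le[OF P.entropy_tendsto Q.entropy_tendsto] exI[of _ 0]) simp
qed

context sweeping
begin

lemma coded_processI:
  assumes "finite_measurable_partition M Q" "\<And>q. q \<in> Q \<Longrightarrow> q \<subseteq> E \<or> q \<inter> E = {}"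
  shows "coded_process M T E Q"
  using assms by unfold_locales

text \<open>
Cutting the cells of \<open>P\<close> along \<open>E\<close> does not decrease the entropy and makes the visits visible. The error term vanishes as
the excursions are cut off later and later.
\<close>
lemma entropy_le_induced_KS:
  assumes P: "finite_measurable_partition M P"
  shows "ennreal (entropy_wrt M T P) \<le> emeasure M E * KS_entropy N S"
proof -
  define Q where "Q = ((\<lambda>A. A \<inter> E) ` P \<union> (\<lambda>A. A - E) ` P) - {{}}"
  have part: "partition_on (space M) P" and fin: "finite P" and Ps: "P \<subseteq> sets M"
    using P by (auto simp: finite_measurable_partition_def)
  have Q: "finite_measurable_partition M Q"
    unfolding finite_measurable_partition_def
  proof (intro conjI)
    show "finite Q" using fin by (simp add: Q_def)
    show "Q \<subseteq> sets M" using Ps by (auto simp: Q_def)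
    show "partition_on (space M) Q"
    proof (rule partition_onI)
      have "x \<in> \<Union> Q" if "x \<in> A" "A \<in> P" for x A
      proof (cases "x \<in> E")
        case True
        then have "A \<inter> E \<in> Q" using that by (auto simp: Q_def)
        then show ?thesis using that True by blast
      next
        case False
        then have "A - E \<in> Q" using that by (auto simp: Q_def)
        then show ?thesis using that False by blast
      qed
      moreover have "\<Union> Q \<subseteq> \<Union> P" by (auto simp: Q_def)
      ultimately show "\<Union> Q = space M" unfolding partition_onD1[OF part] by blast
      show "disjnt A B" if "A \<in> Q" "B \<in> Q" "A \<noteq> B" for A B
        using that disjointD[OF partition_onD2[OF part]] by (fastforce simp: Q_def disjnt_def)
    qed (simp add: Q_def)
  qed
  interpret coded_process M T E Q by (rule coded_processI[OF Q]) (auto simp: Q_def)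
  have PQ: "entropy_wrt M T P \<le> entropy_wrt M T Q"
    by (rule entropy_wrt_mono_refinement[OF P Q]) (auto simp: Q_def)
  have c: "emeasure M E = ennreal (measure M E)" by (rule emeasure_eq_measure)
  show ?thesis
  proof (cases "KS_entropy N S = \<top>")
    case True
    then show ?thesis using measure_E_pos by (simp add: c ennreal_mult_top)
  next
    case False
    then obtain k where k: "KS_entropy N S = ennreal k" "k \<ge> 0" by (cases "KS_entropy N S") auto
    have le_k: "entropy_wrt N S (excursion_partition l) \<le> k" for l
    proof -
      have "ennreal (entropy_wrt N S (excursion_partition l)) \<le> ennreal k"
        unfolding k(1)[symmetric] KS_entropy_def
        by (rule SUP_upper) (simp add: excursion_partition)
      then show ?thesis using k(2) by simp
    qed
    have le: "entropy_wrt M T Q \<le> ln (card Q) * measure M (rare 0 l) + measure M E * k"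
      for l
      using entropy_le_induced[of l] mult_left_mono[OF le_k[of l] measure_nonneg[of M E]]
      by linarith
    have "(\<lambda>l. ln (card Q) * measure M (rare 0 l) + measure M E * k)
        \<longlonglongrightarrow> ln (card Q) * 0 + measure M E * k"
      by (intro tendsto_intros rare_measure_tendsto_0)
    then have "entropy_wrt M T Q \<le> ln (card Q) * 0 + measure M E * k"
      by (rule LIMSEQ_le_const) (use le in auto)
    then show ?thesis
      using PQ k by (simp add: c ennreal_mult[symmetric] ennreal_leI)
  qed
qed

text \<open>
A partition of \<open>E\<close> is completed to one of the whole space by the complement of \<open>E\<close>.
\<close>
lemma induced_entropy_le_KS:
  assumes P: "finite_measurable_partition N P"
  shows "emeasure M E * ennreal (entropy_wrt N S P) \<le> KS_entropy M T"
proof -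
  define Q where "Q = insert (space M - E) P - {{}}"
  have part: "partition_on E P" and fin: "finite P" and Ps: "P \<subseteq> sets N"
    using P by (auto simp: finite_measurable_partition_def)
  have PE: "A \<subseteq> E" if "A \<in> P" for A using partition_onD1[OF part] that by blast
  have Q: "finite_measurable_partition M Q"
    unfolding finite_measurable_partition_def
  proof (intro conjI)
    show "finite Q" using fin by (simp add: Q_def)
    show "Q \<subseteq> sets M" using Ps by (auto simp: Q_def sets_N_iff)
    show "partition_on (space M) Q"
    proof (rule partition_onI)
      show "\<Union> Q = space M" using partition_onD1[OF part] E_space by (auto simp: Q_def)
      show "disjnt A B" if "A \<in> Q" "B \<in> Q" "A \<noteq> B" for A B
        using that disjointD[OF partition_onD2[OF part]] PE by (fastforce simp: Q_def disjnt_def)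
    qed (simp add: Q_def)
  qed
  interpret coded_process M T E Q
    by (rule coded_processI[OF Q]) (use PE in \<open>auto simp: Q_def\<close>)
  interpret NP: finite_process N S P by (rule partition_N_process[OF P])
  have "P \<subseteq> Q" using partition_onD3[OF part] by (auto simp: Q_def)
  then have "measure M E * entropy_wrt N S P \<le> entropy_wrt M T Q" by (rule induced_entropy_le[OF P])
  then have "ennreal (measure M E * entropy_wrt N S P) \<le> ennreal (entropy_wrt M T Q)"
    by (rule ennreal_leI)
  moreover have "ennreal (entropy_wrt M T Q) \<le> KS_entropy M T"
    unfolding KS_entropy_def by (rule SUP_upper) (simp add: Q)
  moreover have "ennreal (measure M E * entropy_wrt N S P) = emeasure M E * ennreal (entropy_wrt N S P)"
    by (simp add: emeasure_eq_measure ennreal_mult')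
  ultimately show ?thesis by simp
qed

end

theorem theorem5p1:
  fixes M :: "'a measure" and T :: "'a \<Rightarrow> 'a" and E :: "'a set"
  assumes "measure_preserving_system M T"
    and "sweeps_out M T E"
  shows "KS_entropy M T = emeasure M E * KS_entropy (induced_measure M E) (induced_map T E)"
proof -
  interpret prob_space M
    using assms(1) by (simp add: measure_preserving_system_def standard_prob_space_def)
  interpret sweeping M T E
    using assms by unfold_locales (simp_all add: measure_preserving_system_def)
  show ?thesis
  proof (rule antisym)
    show "KS_entropy M T \<le> emeasure M E * KS_entropy N S"
      unfolding KS_entropy_def[of M] by (rule SUP_least) (simp add: entropy_le_induced_KS)
    show "emeasure M E * KS_entropy N S \<le> KS_entropy M T"
      unfolding KS_entropy_def[of N] SUP_mult_left_ennreal
      by (rule SUP_least) (simp add: induced_entropy_le_KS)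
  qed
qed

end
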